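(* For every $n \ge 2$, the pure virtual twin group $PVT_n$ is an irreducible right-angled Artin group.
   Context: For $n\ge 2$, the virtual twin group $VT_n$ is the group with generators $s_1,\dots,s_{n-1},\rho_1,\dots,\rho_{n-1}$ and defining relations: $s_i^2=1$ and $\rho_i^2=1$ for $1\le i\le n-1$; $s_is_j=s_js_i$, $\rho_i\rho_j=\rho_j\rho_i$ and $\rho_is_j=s_j\rho_i$ for $|i-j|\ge 2$; $\rho_i\rho_{i+1}\rho_i=\rho_{i+1}\rho_i\rho_{i+1}$ and $\rho_i\rho_{i+1}s_i=s_{i+1}\rho_i\rho_{i+1}$ for $1\le i\le n-2$. The pure virtual twin group $PVT_n$ is the kernel of the surjection $\pi:VT_n\to S_n$, $\pi(s_i)=\pi(\rho_i)=(i,i+1)$. A group is a right-angled Artin group if it has a presentation in which the only relations are commuting relations among generators. A right-angled Artin group is irreducible if it is not a direct product of two non-trivial groups. *)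

theory Defs
  imports "HOL-Algebra.Sym_Groups" "HOL-Algebra.Elementary_Groups"
begin

section \<open>Groups given by generators and relations\<close>

text \<open>The letter \<open>(x, True)\<close> stands for the generator \<open>x\<close>, and \<open>(x, False)\<close>
  for its formal inverse.\<close>

type_synonym 'x word = "('x \<times> bool) list"

definition words :: "'x set \<Rightarrow> 'x word set"
  where "words X = lists (X \<times> UNIV)"

definition pos_word :: "'x list \<Rightarrow> 'x word"
  where "pos_word xs = map (\<lambda>x. (x, True)) xs"

text \<open>A pair \<open>(u, v)\<close> in \<open>R\<close> is the defining relation \<open>u = v\<close>; pairs that are not
  pairs of words over \<open>X\<close> are disregarded.\<close>

inductive word_cong :: "'x set \<Rightarrow> ('x word \<times> 'x word) set \<Rightarrow> 'x word \<Rightarrow> 'x word \<Rightarrow> bool"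
  for X :: "'x set" and R :: "('x word \<times> 'x word) set"
where
  refl: "w \<in> words X \<Longrightarrow> word_cong X R w w"
| sym: "word_cong X R u v \<Longrightarrow> word_cong X R v u"
| trans: "word_cong X R u v \<Longrightarrow> word_cong X R v w \<Longrightarrow> word_cong X R u w"
| append: "word_cong X R u u' \<Longrightarrow> word_cong X R v v' \<Longrightarrow> word_cong X R (u @ v) (u' @ v')"
| cancel: "x \<in> X \<Longrightarrow> word_cong X R [(x, b), (x, \<not> b)] []"
| relation: "(u, v) \<in> R \<Longrightarrow> u \<in> words X \<Longrightarrow> v \<in> words X \<Longrightarrow> word_cong X R u v"

definition word_rel :: "'x set \<Rightarrow> ('x word \<times> 'x word) set \<Rightarrow> ('x word \<times> 'x word) set"
  where "word_rel X R = {(u, v). word_cong X R u v}"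

definition presented_group :: "'x set \<Rightarrow> ('x word \<times> 'x word) set \<Rightarrow> 'x word set monoid"
  where "presented_group X R =
    \<lparr> carrier = words X // word_rel X R,
      mult = (\<lambda>A B. word_rel X R `` {a @ b | a b. a \<in> A \<and> b \<in> B}),
      one = word_rel X R `` {[]} \<rparr>"

text \<open>The homomorphism out of a presented group determined by the images \<open>f\<close> of the
  generators: all words in a class have the same value (see \<open>presented_lift_class\<close>).\<close>

definition word_eval :: "('a, 'm) monoid_scheme \<Rightarrow> ('x \<Rightarrow> 'a) \<Rightarrow> 'x word \<Rightarrow> 'a"
  where "word_eval H f w =
    foldr (\<lambda>(x, b) h. (if b then f x else inv\<^bsub>H\<^esub> (f x)) \<otimes>\<^bsub>H\<^esub> h) w \<one>\<^bsub>H\<^esub>"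

definition presented_lift ::
    "('a, 'm) monoid_scheme \<Rightarrow> ('x \<Rightarrow> 'a) \<Rightarrow> 'x word set \<Rightarrow> 'a"
  where "presented_lift H f A = the_elem (word_eval H f ` A)"

lemma words_Nil [simp]: "[] \<in> words X"
  by (simp add: words_def)

lemma words_Cons [simp]: "p # w \<in> words X \<longleftrightarrow> fst p \<in> X \<and> w \<in> words X"
  by (cases p) (auto simp: words_def)

lemma words_append [simp]: "u @ v \<in> words X \<longleftrightarrow> u \<in> words X \<and> v \<in> words X"
  by (auto simp: words_def)

lemma pos_word_in_words [simp]: "pos_word xs \<in> words X \<longleftrightarrow> set xs \<subseteq> X"
  by (auto simp: pos_word_def words_def)

lemma word_cong_words: "word_cong X R u v \<Longrightarrow> u \<in> words X \<and> v \<in> words X"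
  by (induction rule: word_cong.induct) auto

lemma equiv_word_rel: "equiv (words X) (word_rel X R)"
  by (rule equivI)
    (auto simp: word_rel_def refl_on_def sym_def trans_def
      dest: word_cong_words intro: word_cong.intros)

lemma word_rel_class_eq:
  "word_cong X R u v \<Longrightarrow> word_rel X R `` {u} = word_rel X R `` {v}"
  by (rule equiv_class_eq[OF equiv_word_rel]) (simp add: word_rel_def)

lemma presented_carrierE:
  assumes "A \<in> carrier (presented_group X R)"
  obtains w where "w \<in> words X" "A = word_rel X R `` {w}"
  using assms by (auto simp: presented_group_def elim: quotientE)

lemma presented_carrierI:
  "w \<in> words X \<Longrightarrow> word_rel X R `` {w} \<in> carrier (presented_group X R)"
  by (auto simp: presented_group_def intro: quotientI)

lemma presented_mult:
  assumes "u \<in> words X" "v \<in> words X"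
  shows "word_rel X R `` {u} \<otimes>\<^bsub>presented_group X R\<^esub> word_rel X R `` {v} = word_rel X R `` {u @ v}"
proof -
  have "word_cong X R (u @ v) w"
    if "word_cong X R u a" "word_cong X R v b" "word_cong X R (a @ b) w" for a b w
    using that by (meson word_cong.append word_cong.trans)
  moreover have "word_cong X R u u" "word_cong X R v v"
    using assms by (auto intro: word_cong.refl)
  ultimately show ?thesis
    by (auto simp: presented_group_def word_rel_def)
qed

lemma presented_one: "\<one>\<^bsub>presented_group X R\<^esub> = word_rel X R `` {[]}"
  by (simp add: presented_group_def)

lemma word_inverse:
  assumes "w \<in> words X"
  shows "\<exists>v \<in> words X. word_cong X R (v @ w) []"
  using assms
proof (induction w)
  case Nil
  show ?case by (rule bexI[of _ "[]"]) (auto intro: word_cong.refl)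
next
  case (Cons p w)
  obtain x b where p: "p = (x, b)" by (cases p)
  from Cons p have x: "x \<in> X" "w \<in> words X" by auto
  with Cons obtain v where v: "v \<in> words X" "word_cong X R (v @ w) []" by auto
  have "word_cong X R ([(x, \<not> b), (x, b)] @ w) ([] @ w)"
    using x word_cong.cancel[of x X R "\<not> b"] by (intro word_cong.append word_cong.refl) simp_all
  then have "word_cong X R (v @ ([(x, \<not> b), (x, b)] @ w)) (v @ ([] @ w))"
    using v(1) by (intro word_cong.append[OF word_cong.refl])
  then have "word_cong X R ((v @ [(x, \<not> b)]) @ (p # w)) []"
    using v(2) p by (auto intro: word_cong.trans)
  then show ?case using v x by (intro bexI[of _ "v @ [(x, \<not> b)]"]) auto
qed

lemma group_presented_group: "group (presented_group X R)"
proof (rule groupI)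
  fix A assume "A \<in> carrier (presented_group X R)"
  then obtain w where w: "w \<in> words X" "A = word_rel X R `` {w}" by (rule presented_carrierE)
  then obtain v where v: "v \<in> words X" "word_cong X R (v @ w) []" using word_inverse by blast
  then have "word_rel X R `` {v} \<otimes>\<^bsub>presented_group X R\<^esub> A = \<one>\<^bsub>presented_group X R\<^esub>"
    by (simp add: w presented_mult presented_one word_rel_class_eq)
  with v show "\<exists>B\<in>carrier (presented_group X R).
      B \<otimes>\<^bsub>presented_group X R\<^esub> A = \<one>\<^bsub>presented_group X R\<^esub>"
    using presented_carrierI by blast
qed (auto simp: presented_mult presented_one elim!: presented_carrierE intro!: presented_carrierI)

lemma (in group) word_eval_closed:
  assumes "f \<in> X \<rightarrow> carrier G" "w \<in> words X"
  shows "word_eval G f w \<in> carrier G"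
  using assms(2)
proof (induction w)
  case (Cons p w)
  then have "f (fst p) \<in> carrier G" using assms(1) by auto
  with Cons show ?case by (auto simp: word_eval_def split: prod.splits)
qed (simp add: word_eval_def)

lemma (in group) word_eval_append:
  assumes f: "f \<in> X \<rightarrow> carrier G" and "u \<in> words X" "v \<in> words X"
  shows "word_eval G f (u @ v) = word_eval G f u \<otimes> word_eval G f v"
  using assms(2)
proof (induction u)
  case Nil
  then show ?case using word_eval_closed[OF f assms(3)] by (simp add: word_eval_def)
next
  case (Cons p u)
  obtain x b where p: "p = (x, b)" by (cases p)
  with Cons f have "f x \<in> carrier G" by auto
  then show ?case
    using Cons p word_eval_closed[OF f, of u] word_eval_closed[OF f assms(3)]
    by (simp add: word_eval_def m_assoc)
qed

lemma (in group) word_eval_cong: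
  assumes f: "f \<in> X \<rightarrow> carrier G"
    and R: "\<And>u v. (u, v) \<in> R \<Longrightarrow> u \<in> words X \<Longrightarrow> v \<in> words X \<Longrightarrow> word_eval G f u = word_eval G f v"
    and "word_cong X R u v"
  shows "word_eval G f u = word_eval G f v"
  using assms(3)
proof (induction rule: word_cong.induct)
  case (append u u' v v')
  then show ?case using word_eval_append[OF f] word_cong_words by metis
next
  case (cancel x b)
  then have "f x \<in> carrier G" using f by auto
  then show ?case by (simp add: word_eval_def)
qed (auto simp: R)

lemma (in group) presented_lift_class:
  assumes "f \<in> X \<rightarrow> carrier G"
    and "\<And>u v. (u, v) \<in> R \<Longrightarrow> u \<in> words X \<Longrightarrow> v \<in> words X \<Longrightarrow> word_eval G f u = word_eval G f v"
    and "w \<in> words X"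
  shows "presented_lift G f (word_rel X R `` {w}) = word_eval G f w"
proof -
  have "word_eval G f ` (word_rel X R `` {w}) = {word_eval G f w}"
    using word_eval_cong[OF assms(1,2)] word_cong.refl[OF assms(3)]
    by (fastforce simp: word_rel_def)
  then show ?thesis by (simp add: presented_lift_def)
qed

lemma (in group) presented_lift_hom:
  assumes "f \<in> X \<rightarrow> carrier G"
    and "\<And>u v. (u, v) \<in> R \<Longrightarrow> u \<in> words X \<Longrightarrow> v \<in> words X \<Longrightarrow> word_eval G f u = word_eval G f v"
  shows "presented_lift G f \<in> hom (presented_group X R) G"
  using assms
  by (auto simp: hom_def presented_mult presented_lift_class word_eval_append word_eval_closed
      elim!: presented_carrierE)


section \<open>Irreducible right-angled Artin groups\<close>

text \<open>Distinct generators of a right-angled Artin group are distinct elements of it, so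
  taking the generating set \<open>X\<close> in the element type of \<open>G\<close> loses no generality.\<close>

definition commuting_relations :: "('x \<times> 'x) set \<Rightarrow> ('x word \<times> 'x word) set"
  where "commuting_relations E = {(pos_word [x, y], pos_word [y, x]) | x y. (x, y) \<in> E}"

definition right_angled_Artin_group :: "('a, 'm) monoid_scheme \<Rightarrow> bool"
  where "right_angled_Artin_group G \<longleftrightarrow> group G \<and>
    (\<exists>(X :: 'a set) E. E \<subseteq> X \<times> X \<and> G \<cong> presented_group X (commuting_relations E))"

text \<open>The factors of a direct product are isomorphic to subgroups of it, so again the
  element type of \<open>G\<close> suffices for them (see \<open>irreducible_group_no_product\<close>).\<close>

definition irreducible_group :: "('a, 'm) monoid_scheme \<Rightarrow> bool"
  where "irreducible_group G \<longleftrightarrow>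
    \<not> (\<exists>(H :: 'a monoid) (K :: 'a monoid). group H \<and> group K \<and>
        \<not> trivial_group H \<and> \<not> trivial_group K \<and> G \<cong> H \<times>\<times> K)"

lemma copy_of_group:
  fixes H :: "('b, 'm) monoid_scheme" and g :: "'b \<Rightarrow> 'a"
  assumes "group H" and g: "inj_on g (carrier H)"
  shows "\<exists>H' :: 'a monoid. group H' \<and> H \<cong> H' \<and> (trivial_group H' \<longrightarrow> trivial_group H)"
proof -
  interpret H: group H by fact
  let ?i = "inv_into (carrier H) g"
  define H' :: "'a monoid" where "H' = \<lparr> carrier = g ` carrier H,
     mult = (\<lambda>a b. g (?i a \<otimes>\<^bsub>H\<^esub> ?i b)), one = g \<one>\<^bsub>H\<^esub> \<rparr>"
  have iso: "g \<in> iso H H'"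
    using g by (auto simp: H'_def iso_def hom_def bij_betw_def)
  have "group H'"
  proof -
    have "H'\<lparr>carrier := g ` carrier H, one := g \<one>\<^bsub>H\<^esub>\<rparr> = H'" by (simp add: H'_def)
    then show ?thesis using H.iso_imp_img_group[OF iso] by (simp add: H'_def)
  qed
  moreover have "trivial_group H" if "trivial_group H'"
  proof -
    have "carrier H \<subseteq> {\<one>\<^bsub>H\<^esub>}"
      using that g unfolding trivial_group_def H'_def by (auto dest: inj_onD)
    then show ?thesis using H.trivial_group_subset by blast
  qed
  ultimately show ?thesis using iso unfolding is_iso_def by blast
qed

lemma irreducible_group_no_product:
  fixes G :: "('a, 'm) monoid_scheme" and H :: "'b monoid" and K :: "'c monoid"
  assumes "group G" "irreducible_group G" "group H" "group K" "G \<cong> H \<times>\<times> K"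
  shows "trivial_group H \<or> trivial_group K"
proof (rule ccontr)
  assume nontriv: "\<not> (trivial_group H \<or> trivial_group K)"
  interpret H: group H by fact
  interpret K: group K by fact
  have "H \<times>\<times> K \<cong> G"
    by (rule group.iso_sym) (use assms in auto)
  then obtain \<psi> where \<psi>: "\<psi> \<in> iso (H \<times>\<times> K) G"
    unfolding is_iso_def by blast
  have inj: "inj_on \<psi> (carrier H \<times> carrier K)"
    using \<psi> by (auto simp: iso_def bij_betw_def DirProd_def)
  have "inj_on (\<lambda>h. \<psi> (h, \<one>\<^bsub>K\<^esub>)) (carrier H)" "inj_on (\<lambda>k. \<psi> (\<one>\<^bsub>H\<^esub>, k)) (carrier K)"
    by (auto intro!: inj_onI dest!: inj_onD[OF inj])
  then obtain H' K' :: "'a monoid"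
    where "group H'" "H \<cong> H'" "\<not> trivial_group H'" "group K'" "K \<cong> K'" "\<not> trivial_group K'"
    using copy_of_group[OF \<open>group H\<close>] copy_of_group[OF \<open>group K\<close>] nontriv by metis
  moreover from this have "G \<cong> H' \<times>\<times> K'"
    using assms(3-5) H.DirProd_iso_trans iso_trans by blast
  ultimately show False using assms(2) unfolding irreducible_group_def by blast
qed


section \<open>Virtual twin groups\<close>

datatype vt_gen = S nat | Rho nat

definition vt_gens :: "nat \<Rightarrow> vt_gen set"
  where "vt_gens n = S ` {1..n - 1} \<union> Rho ` {1..n - 1}"

definition vt_relations :: "nat \<Rightarrow> (vt_gen word \<times> vt_gen word) set"
  where "vt_relations n =
    {(pos_word [S i, S i], []) | i. i \<in> {1..n - 1}} \<union>
    {(pos_word [Rho i, Rho i], []) | i. i \<in> {1..n - 1}} \<union>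
    {(pos_word [S i, S j], pos_word [S j, S i]) | i j.
       i \<in> {1..n - 1} \<and> j \<in> {1..n - 1} \<and> \<bar>int i - int j\<bar> \<ge> 2} \<union>
    {(pos_word [Rho i, Rho j], pos_word [Rho j, Rho i]) | i j.
       i \<in> {1..n - 1} \<and> j \<in> {1..n - 1} \<and> \<bar>int i - int j\<bar> \<ge> 2} \<union>
    {(pos_word [Rho i, S j], pos_word [S j, Rho i]) | i j.
       i \<in> {1..n - 1} \<and> j \<in> {1..n - 1} \<and> \<bar>int i - int j\<bar> \<ge> 2} \<union>
    {(pos_word [Rho i, Rho (i + 1), Rho i], pos_word [Rho (i + 1), Rho i, Rho (i + 1)]) | i.
       i \<in> {1..n - 2}} \<union>
    {(pos_word [Rho i, Rho (i + 1), S i], pos_word [S (i + 1), Rho i, Rho (i + 1)]) | i.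
       i \<in> {1..n - 2}}"

definition virtual_twin_group :: "nat \<Rightarrow> vt_gen word set monoid"
  where "virtual_twin_group n = presented_group (vt_gens n) (vt_relations n)"

fun vt_transposition :: "vt_gen \<Rightarrow> nat \<Rightarrow> nat" where
  "vt_transposition (S i) = transpose i (i + 1)"
| "vt_transposition (Rho i) = transpose i (i + 1)"

definition vt_proj :: "nat \<Rightarrow> vt_gen word set \<Rightarrow> nat \<Rightarrow> nat"
  where "vt_proj n = presented_lift (sym_group n) vt_transposition"

definition pure_virtual_twin_group :: "nat \<Rightarrow> vt_gen word set monoid"
  where "pure_virtual_twin_group n = (virtual_twin_group n)
    \<lparr> carrier := kernel (virtual_twin_group n) (sym_group n) (vt_proj n) \<rparr>"

lemma group_virtual_twin_group: "group (virtual_twin_group n)"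
  by (simp add: virtual_twin_group_def group_presented_group)

lemma vt_transposition_closed: "vt_transposition \<in> vt_gens n \<rightarrow> carrier (sym_group n)"
  by (auto simp: vt_gens_def sym_group_carrier intro!: permutes_swap_id)

lemma word_eval_pos_word:
  "word_eval (sym_group n) vt_transposition (pos_word xs) = foldr (\<lambda>x h. vt_transposition x \<circ> h) xs id"
  by (induction xs) (auto simp: word_eval_def pos_word_def sym_group_mult sym_group_one)

lemma vt_relations_respected:
  assumes "(u, v) \<in> vt_relations n"
  shows "word_eval (sym_group n) vt_transposition u = word_eval (sym_group n) vt_transposition v"
proof -
  have Nil: "word_eval (sym_group n) vt_transposition [] = id"
    by (simp add: word_eval_def sym_group_one)
  show ?thesis
    using assms unfolding vt_relations_def
    by (auto simp: word_eval_pos_word Nil fun_eq_iff transpose_def)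
qed

lemma vt_proj_hom: "vt_proj n \<in> hom (virtual_twin_group n) (sym_group n)"
  unfolding vt_proj_def virtual_twin_group_def
  by (rule group.presented_lift_hom[OF sym_group_is_group vt_transposition_closed])
    (rule vt_relations_respected)

lemma vt_proj_generator:
  assumes "x \<in> vt_gens n"
  shows "vt_proj n (word_rel (vt_gens n) (vt_relations n) `` {pos_word [x]}) = vt_transposition x"
  unfolding vt_proj_def
  by (subst group.presented_lift_class[OF sym_group_is_group vt_transposition_closed])
    (use assms vt_relations_respected in \<open>auto simp: word_eval_pos_word\<close>)

lemma group_pure_virtual_twin_group: "group (pure_virtual_twin_group n)"
proof -
  interpret group_hom "virtual_twin_group n" "sym_group n" "vt_proj n"
    by (simp add: group_hom_def group_hom_axioms_def group_virtual_twin_group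
        sym_group_is_group vt_proj_hom)
  show ?thesis
    unfolding pure_virtual_twin_group_def
    by (rule subgroup.subgroup_is_group[OF subgroup_kernel group_virtual_twin_group])
qed

end

theory Submission
  imports Defs
begin

text \<open>
  The subgroup of \<open>VT\<^sub>n\<close> generated by the \<open>\<rho>\<^sub>i\<close> is a copy of \<open>S\<^sub>n\<close> that \<open>\<pi>\<close> maps
  isomorphically onto \<open>S\<^sub>n\<close>.  Hence \<open>VT\<^sub>n\<close> is the semidirect product of \<open>PVT\<^sub>n\<close> with this copy.
  The element \<open>\<lambda>\<^sub>1\<^sub>2 = s\<^sub>1 \<rho>\<^sub>1\<close> is pure and commutes with the stabiliser of \<open>1\<close> and \<open>2\<close>,
  so its conjugates by permutations are elements \<open>\<lambda>\<^sub>i\<^sub>j\<close> with \<open>i \<noteq> j\<close>, which \<open>S\<^sub>n\<close> permutes through their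
  indices.  They satisfy \<open>\<lambda>\<^sub>j\<^sub>i = \<lambda>\<^sub>i\<^sub>j\<inverse>\<close>, and \<open>\<lambda>\<^sub>i\<^sub>j\<close> commutes with \<open>\<lambda>\<^sub>k\<^sub>l\<close> if all four indices
  are distinct.  Let \<open>A\<close> be the right-angled Artin group on the pairs \<open>i < j\<close> in which exactly
  disjoint pairs commute.  Sending pairs to the elements \<open>\<lambda>\<^sub>i\<^sub>j\<close> defines a homomorphism \<open>A \<rightarrow> PVT\<^sub>n\<close>.

  It is surjective because \<open>s\<^sub>i = \<lambda>\<^bsub>i,i+1\<^esub> \<rho>\<^sub>i\<close>, so that every element of \<open>VT\<^sub>n\<close> is a product of
  \<open>\<lambda>\<close>'s followed by an element of the copy of \<open>S\<^sub>n\<close> (\<open>decomposition\<close>).  It is injective because \<open>VT\<^sub>n\<close>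
  acts on the set \<open>A\<close>: \<open>\<rho>\<^sub>i\<close> acts as the automorphism that exchanges the indices \<open>i\<close> and \<open>i + 1\<close>, and
  \<open>s\<^sub>i\<close> as the same automorphism followed by left multiplication with the generator of the pair
  \<open>(i, i + 1)\<close>.  Under this action \<open>\<lambda>\<^sub>i\<^sub>j\<close> is left multiplication by the generator of \<open>(i, j)\<close>
  (\<open>affine_act_to_VT\<close>).  That the elements \<open>\<rho>\<^sub>i\<close> really generate a copy of \<open>S\<^sub>n\<close> is the Coxeter
  presentation of the symmetric group (\<open>r_prod_trivial\<close>).

  Irreducibility holds for every right-angled Artin group whose noncommuting graph is connected
  (\<open>raag_irreducible\<close>), and the graph of the pairs \<open>i < j\<close>, in which pairs are joined if
  they meet, is connected.  Suppose that \<open>A\<close> is the direct product of \<open>H\<close> and \<open>K\<close>.  For noncommuting generators \<open>u\<close> and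
  \<open>v\<close>, the map of \<open>A\<close> to the Heisenberg group shows that the exponent vectors of elements of
  \<open>H\<close> and of \<open>K\<close> at \<open>u, v\<close> are linearly dependent.  As all these vectors together span \<open>\<int>\<^sup>2\<close>, one of the two factors has
  zero exponents at \<open>u\<close> and \<open>v\<close>.  (For a single generator, \<open>n = 2\<close>, the group is infinite cyclic and
  the projections are idempotent integers, hence \<open>0\<close> or \<open>1\<close>.)  By connectedness the same factor, say \<open>H\<close>, has zero exponents at all
  generators.  Then \<open>H\<close>, being a retract of \<open>A\<close>, is a perfect group.  But \<open>A\<close> embeds into the invertible power series
  in partially commuting variables by \<open>v \<mapsto> 1 + v\<close>, as Magnus did for free groups
  (\<open>act_faithful\<close>), and the filtration of these series by degree has
  abelian layers, so that a perfect subgroup is trivial (\<open>retraction_trivial\<close>).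
\<close>

section \<open>Homomorphisms and induction on presented groups\<close>

definition gen :: "'x set \<Rightarrow> ('x word \<times> 'x word) set \<Rightarrow> 'x \<Rightarrow> 'x word set"
  where "gen X R x = word_rel X R `` {[(x, True)]}"

text \<open>A function of words that is constant on classes descends to the presented group.  This yields the
exponent sums and the actions \<open>act\<close> and \<open>affine_act\<close> without setting up a target group for each.\<close>

definition on_class :: "('x word \<Rightarrow> 'c) \<Rightarrow> 'x word set \<Rightarrow> 'c"
  where "on_class F A = F (SOME w. w \<in> A)"

lemma on_class:
  assumes "\<And>u v. word_cong X R u v \<Longrightarrow> F u = F v" "w \<in> words X"
  shows "on_class F (word_rel X R `` {w}) = F w"
proof -
  have "w \<in> word_rel X R `` {w}"
    using assms(2) by (auto simp: word_rel_def intro: word_cong.refl)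
  then have "(SOME v. v \<in> word_rel X R `` {w}) \<in> word_rel X R `` {w}"
    by (rule someI)
  then show ?thesis using assms(1) by (auto simp: on_class_def word_rel_def)
qed

lemma gen_closed [intro]: "x \<in> X \<Longrightarrow> gen X R x \<in> carrier (presented_group X R)"
  by (simp add: gen_def presented_carrierI)

lemma class_eqD:
  assumes "word_rel X R `` {u} = word_rel X R `` {v}" "v \<in> words X"
  shows "word_cong X R u v"
proof -
  have "v \<in> word_rel X R `` {v}"
    using assms(2) by (auto simp: word_rel_def intro: word_cong.refl)
  then show ?thesis using assms(1) by (auto simp: word_rel_def)
qed

lemma inv_gen:
  assumes "x \<in> X"
  shows "inv\<^bsub>presented_group X R\<^esub> (gen X R x) = word_rel X R `` {[(x, False)]}"
proof -
  interpret group "presented_group X R" by (rule group_presented_group)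
  have "word_rel X R `` {[(x, False)]} \<otimes>\<^bsub>presented_group X R\<^esub> gen X R x = \<one>\<^bsub>presented_group X R\<^esub>"
    using assms word_cong.cancel[of x X R False]
    by (simp add: gen_def presented_mult presented_one word_rel_class_eq)
  then show ?thesis
    using assms by (intro inv_equality) (auto intro: presented_carrierI)
qed

lemma class_Cons:
  assumes "x \<in> X" "w \<in> words X"
  shows "word_rel X R `` {(x, b) # w} = (if b then gen X R x else inv\<^bsub>presented_group X R\<^esub> gen X R x)
    \<otimes>\<^bsub>presented_group X R\<^esub> word_rel X R `` {w}"
  using assms presented_mult[of "[(x, b)]" X w R] by (cases b) (simp_all add: inv_gen, simp add: gen_def)

lemma presented_induct [consumes 1, case_names one gen inv_gen]:
  fixes X R defines "G \<equiv> presented_group X R"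
  assumes "g \<in> carrier G"
    and "P \<one>\<^bsub>G\<^esub>"
    and "\<And>x h. x \<in> X \<Longrightarrow> h \<in> carrier G \<Longrightarrow> P h \<Longrightarrow> P (gen X R x \<otimes>\<^bsub>G\<^esub> h)"
    and "\<And>x h. x \<in> X \<Longrightarrow> h \<in> carrier G \<Longrightarrow> P h \<Longrightarrow> P (inv\<^bsub>G\<^esub> gen X R x \<otimes>\<^bsub>G\<^esub> h)"
  shows "P g"
proof -
  obtain w where w: "w \<in> words X" "g = word_rel X R `` {w}"
    using assms(2) unfolding G_def by (rule presented_carrierE)
  have "P (word_rel X R `` {w})"
    using w(1)
  proof (induction w)
    case Nil
    then show ?case using assms(3) by (simp add: G_def presented_one)
  next
    case (Cons p w)
    obtain x b where "p = (x, b)" by (cases p)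
    with Cons show ?case
      using assms(4,5)[of x "word_rel X R `` {w}"]
      by (cases b) (auto simp: class_Cons G_def presented_carrierI)
  qed
  with w show ?thesis by simp
qed

lemma presented_hom_eqI:
  assumes "group H" "\<phi> \<in> hom (presented_group X R) H" "\<psi> \<in> hom (presented_group X R) H"
    and "\<And>x. x \<in> X \<Longrightarrow> \<phi> (gen X R x) = \<psi> (gen X R x)"
    and "g \<in> carrier (presented_group X R)"
  shows "\<phi> g = \<psi> g"
proof -
  interpret G: group "presented_group X R" by (rule group_presented_group)
  interpret p: group_hom "presented_group X R" H \<phi>
    using assms by (simp add: group_hom_def group_hom_axioms_def G.group_axioms)
  interpret q: group_hom "presented_group X R" H \<psi>
    using assms by (simp add: group_hom_def group_hom_axioms_def G.group_axioms)
  show ?thesis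
    using assms(5)
    by (induction rule: presented_induct) (simp_all add: assms(4) gen_closed)
qed

lemma (in group) presented_lift_gen:
  assumes "f \<in> X \<rightarrow> carrier G"
    and "\<And>u v. (u, v) \<in> R \<Longrightarrow> u \<in> words X \<Longrightarrow> v \<in> words X \<Longrightarrow> word_eval G f u = word_eval G f v"
    and "x \<in> X"
  shows "presented_lift G f (gen X R x) = f x"
proof -
  have "f x \<in> carrier G" using assms by auto
  then show ?thesis
    unfolding gen_def using assms
    by (subst presented_lift_class[OF assms(1,2)]) (auto simp: word_eval_def)
qed

section \<open>Right-angled Artin groups and exponent sums\<close>

abbreviation raag :: "'x set \<Rightarrow> ('x \<times> 'x) set \<Rightarrow> 'x word set monoid"
  where "raag X E \<equiv> presented_group X (commuting_relations E)"

abbreviation vertex :: "'x set \<Rightarrow> ('x \<times> 'x) set \<Rightarrow> 'x \<Rightarrow> 'x word set"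
  where "vertex X E \<equiv> gen X (commuting_relations E)"

lemma (in group) raag_lift:
  assumes f: "f \<in> X \<rightarrow> carrier G"
    and comm: "\<And>x y. (x, y) \<in> E \<Longrightarrow> x \<in> X \<Longrightarrow> y \<in> X \<Longrightarrow> f x \<otimes> f y = f y \<otimes> f x"
  shows "presented_lift G f \<in> hom (raag X E) G"
    and "\<And>x. x \<in> X \<Longrightarrow> presented_lift G f (vertex X E x) = f x"
proof -
  have R: "word_eval G f u = word_eval G f v"
    if uv: "(u, v) \<in> commuting_relations E" "u \<in> words X" "v \<in> words X" for u v
  proof -
    obtain x y where xy: "(x, y) \<in> E" "u = pos_word [x, y]" "v = pos_word [y, x]"
      using uv by (auto simp: commuting_relations_def)
    with uv have "x \<in> X" "y \<in> X" by auto
    moreover from this have "f x \<in> carrier G" "f y \<in> carrier G" using f by auto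
    ultimately show ?thesis
      using xy comm[of x y] by (simp add: word_eval_def pos_word_def)
  qed
  show "presented_lift G f \<in> hom (raag X E) G"
    by (rule presented_lift_hom[OF f R])
  show "presented_lift G f (vertex X E x) = f x" if "x \<in> X" for x
    by (rule presented_lift_gen[OF f R that])
qed

lemma vertex_commute:
  assumes "x \<in> X" "y \<in> X" "(x, y) \<in> E \<or> (y, x) \<in> E"
  shows "vertex X E x \<otimes>\<^bsub>raag X E\<^esub> vertex X E y = vertex X E y \<otimes>\<^bsub>raag X E\<^esub> vertex X E x"
proof -
  have "word_cong X (commuting_relations E) (pos_word [x, y]) (pos_word [y, x])"
    if "(x, y) \<in> E" "x \<in> X" "y \<in> X" for x y
    using that by (intro word_cong.relation) (auto simp: commuting_relations_def)
  with assms have "word_cong X (commuting_relations E) (pos_word [x, y]) (pos_word [y, x])"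
    by (blast intro: word_cong.sym)
  from word_rel_class_eq[OF this] show ?thesis
    using assms by (simp add: gen_def presented_mult pos_word_def)
qed

definition letter_exp :: "bool \<Rightarrow> int" where "letter_exp b = (if b then 1 else -1)"

definition exp_word :: "'x \<Rightarrow> 'x word \<Rightarrow> int"
  where "exp_word v w = (\<Sum>(x, b)\<leftarrow>w. if x = v then letter_exp b else 0)"

lemma exp_word_simps [simp]:
  "exp_word v [] = 0"
  "exp_word v ((x, b) # w) = (if x = v then letter_exp b else 0) + exp_word v w"
  "exp_word v (u @ w) = exp_word v u + exp_word v w"
  by (simp_all add: exp_word_def)

lemma exp_word_cong:
  "word_cong X (commuting_relations E) u w \<Longrightarrow> exp_word v u = exp_word v w"
  by (induction rule: word_cong.induct)
    (auto simp: letter_exp_def commuting_relations_def pos_word_def)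

abbreviation exp_sum :: "'x \<Rightarrow> 'x word set \<Rightarrow> int"
  where "exp_sum v \<equiv> on_class (exp_word v)"

lemma exp_sum_class:
  "w \<in> words X \<Longrightarrow> exp_sum v (word_rel X (commuting_relations E) `` {w}) = exp_word v w"
  by (rule on_class[OF exp_word_cong])

lemma exp_sum_mult:
  assumes "g \<in> carrier (raag X E)" "h \<in> carrier (raag X E)"
  shows "exp_sum v (g \<otimes>\<^bsub>raag X E\<^esub> h) = exp_sum v g + exp_sum v h"
  using assms by (auto elim!: presented_carrierE simp: presented_mult exp_sum_class)

lemma exp_sum_vertex:
  "x \<in> X \<Longrightarrow> exp_sum v (vertex X E x) = (if x = v then 1 else 0)"
  by (auto simp: gen_def exp_sum_class letter_exp_def)

lemma vertex_inj: "inj_on (vertex X E) X"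
proof (rule inj_onI)
  fix x y assume xy: "x \<in> X" "y \<in> X" "vertex X E x = vertex X E y"
  then have "exp_sum x (vertex X E x) = exp_sum x (vertex X E y)" by simp
  then show "x = y"
    unfolding exp_sum_vertex[OF xy(1)] exp_sum_vertex[OF xy(2)] by (simp split: if_splits)
qed

text \<open>The exponent sums are the coordinates of the abelianization, which is free abelian on the vertices,
so they determine every homomorphism to an abelian group.  A sum over all of the possibly infinite
\<open>X\<close> is replaced by one over any finite set that contains the letters of a chosen word.\<close>

lemma additive_eq_exp_sums:
  fixes \<phi> :: "'x word set \<Rightarrow> int"
  assumes add: "\<And>g h. g \<in> carrier (raag X E) \<Longrightarrow> h \<in> carrier (raag X E) \<Longrightarrow>
      \<phi> (g \<otimes>\<^bsub>raag X E\<^esub> h) = \<phi> g + \<phi> h"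
    and g: "g \<in> carrier (raag X E)"
  obtains F where "finite F" "F \<subseteq> X"
    "\<And>F'. finite F' \<Longrightarrow> F \<subseteq> F' \<Longrightarrow> \<phi> g = (\<Sum>v\<in>F'. exp_sum v g * \<phi> (vertex X E v))"
proof -
  interpret group "raag X E" by (rule group_presented_group)
  have one: "\<phi> \<one>\<^bsub>raag X E\<^esub> = 0" using add[of "\<one>\<^bsub>raag X E\<^esub>" "\<one>\<^bsub>raag X E\<^esub>"] by simp
  have inv: "\<phi> (inv\<^bsub>raag X E\<^esub> h) = - \<phi> h" if "h \<in> carrier (raag X E)" for h
    using add[of "inv\<^bsub>raag X E\<^esub> h" h] that one by simp
  obtain w where w: "w \<in> words X" "g = word_rel X (commuting_relations E) `` {w}"
    using g by (rule presented_carrierE)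
  have "\<phi> (word_rel X (commuting_relations E) `` {w}) = (\<Sum>v\<in>F. exp_word v w * \<phi> (vertex X E v))"
    if "w \<in> words X" "fst ` set w \<subseteq> F" "finite F" for w F
    using that
  proof (induction w)
    case Nil
    then show ?case using one by (simp add: presented_one)
  next
    case (Cons p w)
    obtain x b where p: "p = (x, b)" by (cases p)
    with Cons.prems have x: "x \<in> X" "x \<in> F" by auto
    have "\<phi> (word_rel X (commuting_relations E) `` {p # w})
        = letter_exp b * \<phi> (vertex X E x) + \<phi> (word_rel X (commuting_relations E) `` {w})"
      using Cons.prems x p
      by (simp add: class_Cons add inv gen_closed presented_carrierI letter_exp_def)
    also have "\<dots> = (\<Sum>v\<in>F. exp_word v (p # w) * \<phi> (vertex X E v))"
    proof -
      have "(\<Sum>v\<in>F. (if x = v then letter_exp b else 0) * \<phi> (vertex X E v))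
          = (\<Sum>v\<in>F. if v = x then letter_exp b * \<phi> (vertex X E v) else 0)"
        by (intro sum.cong) auto
      also have "\<dots> = letter_exp b * \<phi> (vertex X E x)"
        using x Cons.prems by simp
      finally show ?thesis using Cons p by (simp add: distrib_right sum.distrib)
    qed
    finally show ?case .
  qed
  then have "\<phi> g = (\<Sum>v\<in>F. exp_sum v g * \<phi> (vertex X E v))"
    if "finite F" "fst ` set w \<subseteq> F" for F
    using that w by (simp add: exp_sum_class)
  moreover have "fst ` set w \<subseteq> X" using w(1) by (auto simp: words_def)
  ultimately show thesis using that[of "fst ` set w"] by simp
qed

text \<open>For an occurrence of \<open>u\<close> before one of \<open>v\<close>, multiply the two exponents, and sum over all such
occurrences: the corner entry of the matrix of the word in the Heisenberg group when
\<open>u\<close> and \<open>v\<close> go to its two standard generators.\<close>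

fun pair_word :: "'x \<Rightarrow> 'x \<Rightarrow> 'x word \<Rightarrow> int" where
  "pair_word u v [] = 0"
| "pair_word u v ((x, b) # w) = (if x = u then letter_exp b * exp_word v w else 0) + pair_word u v w"

lemma pair_word_append:
  "pair_word u v (w @ w') = pair_word u v w + pair_word u v w' + exp_word u w * exp_word v w'"
  by (induction u v w rule: pair_word.induct) (auto simp: algebra_simps)

lemma pair_word_cong:
  assumes "u \<noteq> v" "(u, v) \<notin> E" "(v, u) \<notin> E"
  shows "word_cong X (commuting_relations E) w w' \<Longrightarrow> pair_word u v w = pair_word u v w'"
proof (induction rule: word_cong.induct)
  case (append w1 w1' w2 w2')
  then show ?case by (simp add: pair_word_append exp_word_cong[OF append.hyps(1)] exp_word_cong[OF append.hyps(2)])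
qed (use assms in \<open>auto simp: commuting_relations_def pos_word_def letter_exp_def\<close>)

text \<open>Two elements of the Heisenberg group commute only if their images in the abelianization
\<open>\<int>\<^sup>2\<close> are linearly dependent.\<close>

lemma commuting_elements_exp_sums:
  assumes uv: "u \<noteq> v" "(u, v) \<notin> E" "(v, u) \<notin> E"
    and g: "g \<in> carrier (raag X E)" "h \<in> carrier (raag X E)"
    and comm: "g \<otimes>\<^bsub>raag X E\<^esub> h = h \<otimes>\<^bsub>raag X E\<^esub> g"
  shows "exp_sum u g * exp_sum v h = exp_sum v g * exp_sum u h"
proof -
  obtain a b where a: "a \<in> words X" "g = word_rel X (commuting_relations E) `` {a}"
    and b: "b \<in> words X" "h = word_rel X (commuting_relations E) `` {b}"
    using g by (auto elim!: presented_carrierE)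
  then have "word_cong X (commuting_relations E) (a @ b) (b @ a)"
    using comm by (intro class_eqD) (simp_all add: presented_mult)
  from pair_word_cong[OF uv this] show ?thesis
    using a b by (simp add: pair_word_append exp_sum_class)
qed

section \<open>The Magnus representation of a right-angled Artin group\<close>

text \<open>Consider formal sums of words with integer coefficients in which linked variables are allowed to
commute.  Sending each vertex \<open>v\<close> to \<open>1 + v\<close> embeds the right-angled Artin group into the
invertible ones.  A series is stored as its coefficient function, which is constant
on words that differ by exchanging linked neighbours; multiplication by \<open>1 + v\<close> from the left makes
sense for arbitrary functions of words, so that no quotient of the set of words has to be formed.\<close>

abbreviation linked :: "('x \<times> 'x) set \<Rightarrow> 'x \<Rightarrow> 'x \<Rightarrow> bool"
  where "linked E u v \<equiv> (u, v) \<in> E \<or> (v, u) \<in> E"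

text \<open>Left division of a word by \<open>v\<close>, up to exchanging linked letters: it is possible iff the first \<open>v\<close>
can be moved to the front.  The letter \<open>v\<close> is tested first, so a pair \<open>(v, v)\<close> in \<open>E\<close> is harmless.\<close>

fun strip :: "('x \<times> 'x) set \<Rightarrow> 'x \<Rightarrow> 'x list \<Rightarrow> 'x list option" where
  "strip E v [] = None"
| "strip E v (y # ys) = (if y = v then Some ys
     else if linked E v y then map_option (Cons y) (strip E v ys) else None)"

lemma strip_length: "strip E v w = Some w' \<Longrightarrow> length w = Suc (length w')"
  by (induction w arbitrary: w') (auto split: if_splits)

lemma strip_commute:
  assumes "linked E u v" "u \<noteq> v"
  shows "Option.bind (strip E u w) (strip E v) = Option.bind (strip E v w) (strip E u)"
proof (induction w)
  case (Cons y w)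
  show ?case
  proof (cases "y = u \<or> y = v \<or> \<not> linked E u y \<or> \<not> linked E v y")
    case True
    then show ?thesis using assms
      by (cases "strip E u w"; cases "strip E v w") auto
  next
    case False
    then have "Option.bind (strip E u (y # w)) (strip E v)
        = map_option (Cons y) (Option.bind (strip E u w) (strip E v))"
      by (cases "strip E u w") auto
    moreover from False have "Option.bind (strip E v (y # w)) (strip E u)
        = map_option (Cons y) (Option.bind (strip E v w) (strip E u))"
      by (cases "strip E v w") auto
    ultimately show ?thesis using Cons by simp
  qed
qed simp

text \<open>The coefficient functions of \<open>(1 + v) f\<close> and of \<open>(1 + v)\<inverse> f = f - v ((1 + v)\<inverse> f)\<close>.  The recursion
ends because \<open>strip\<close> shortens the word.\<close>

definition mul :: "('x \<times> 'x) set \<Rightarrow> 'x \<Rightarrow> ('x list \<Rightarrow> int) \<Rightarrow> 'x list \<Rightarrow> int"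
  where "mul E v f w = f w + (case strip E v w of None \<Rightarrow> 0 | Some w' \<Rightarrow> f w')"

function quot :: "('x \<times> 'x) set \<Rightarrow> 'x \<Rightarrow> ('x list \<Rightarrow> int) \<Rightarrow> 'x list \<Rightarrow> int"
  where "quot E v f w = f w - (case strip E v w of None \<Rightarrow> 0 | Some w' \<Rightarrow> quot E v f w')"
  by auto
termination
  by (relation "Wellfounded.measure (\<lambda>(E, v, f, w). length w)") (auto dest: strip_length)

declare quot.simps [simp del]

fun act_word :: "('x \<times> 'x) set \<Rightarrow> 'x word \<Rightarrow> ('x list \<Rightarrow> int) \<Rightarrow> 'x list \<Rightarrow> int" where
  "act_word E [] f = f"
| "act_word E ((v, b) # w) f = (if b then mul E v else quot E v) (act_word E w f)"

lemma mul_quot: "mul E v (quot E v f) = f"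
  by (rule ext) (simp add: mul_def, subst quot.simps, simp split: option.split)

lemma quot_mul: "quot E v (mul E v f) = f"
proof
  fix w show "quot E v (mul E v f) w = f w"
  proof (induction w rule: length_induct)
    case (1 w)
    then show ?case
      by (subst quot.simps, subst mul_def) (auto dest: strip_length split: option.split)
  qed
qed

lemma mul_commute:
  assumes "linked E u v"
  shows "mul E u (mul E v f) = mul E v (mul E u f)"
proof (cases "u = v")
  case False
  show ?thesis
  proof
    fix w
    have "mul E u (mul E v f) w = f w
        + (case strip E v w of None \<Rightarrow> 0 | Some w' \<Rightarrow> f w')
        + (case strip E u w of None \<Rightarrow> 0 | Some w' \<Rightarrow> f w')
        + (case Option.bind (strip E u w) (strip E v) of None \<Rightarrow> 0 | Some w' \<Rightarrow> f w')" for u v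
      by (simp add: mul_def split: option.split)
    then show "mul E u (mul E v f) w = mul E v (mul E u f) w"
      using strip_commute[OF assms False, of w] by simp
  qed
qed simp

lemma act_word_append: "act_word E (u @ w) f = act_word E u (act_word E w f)"
  by (induction E u f rule: act_word.induct) auto

lemma act_word_cong:
  "word_cong X (commuting_relations E) u w \<Longrightarrow> act_word E u = act_word E w"
proof (induction rule: word_cong.induct)
  case (relation u v)
  then obtain x y where "(x, y) \<in> E" "u = pos_word [x, y]" "v = pos_word [y, x]"
    by (auto simp: commuting_relations_def)
  then show ?case
    by (intro ext) (simp add: pos_word_def mul_commute[of x y E])
qed (auto intro!: ext simp: act_word_append mul_quot quot_mul)

abbreviation act :: "('x \<times> 'x) set \<Rightarrow> 'x word set \<Rightarrow> ('x list \<Rightarrow> int) \<Rightarrow> 'x list \<Rightarrow> int"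
  where "act E \<equiv> on_class (act_word E)"

lemma act_class:
  "w \<in> words X \<Longrightarrow> act E (word_rel X (commuting_relations E) `` {w}) = act_word E w"
  by (rule on_class[OF act_word_cong])

lemma act_mult:
  assumes "g \<in> carrier (raag X E)" "h \<in> carrier (raag X E)"
  shows "act E (g \<otimes>\<^bsub>raag X E\<^esub> h) f = act E g (act E h f)"
  using assms by (auto elim!: presented_carrierE simp: presented_mult act_class act_word_append)

lemma act_one: "act E \<one>\<^bsub>raag X E\<^esub> f = f"
  using act_class[of "[]" _ E] by (simp add: presented_one)

lemma act_vertex: "v \<in> X \<Longrightarrow> act E (vertex X E v) f = mul E v f"
  by (simp add: gen_def act_class)

lemma act_inv_vertex: "v \<in> X \<Longrightarrow> act E (inv\<^bsub>raag X E\<^esub> vertex X E v) f = quot E v f"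
  by (simp add: inv_gen act_class)

text \<open>Here \<open>(1 + v)\<^sup>e = 1 + e v + \<dots>\<close>, and the terms after the linear one contribute nothing
at a word that is divisible by \<open>v\<close> at most once.\<close>

lemma act_vertex_pow:
  fixes e :: int
  assumes v: "v \<in> X"
  shows "strip E v w = None \<Longrightarrow> act E (vertex X E v [^]\<^bsub>raag X E\<^esub> e) f w = f w"
    and "strip E v w = Some w' \<Longrightarrow> strip E v w' = None \<Longrightarrow>
      act E (vertex X E v [^]\<^bsub>raag X E\<^esub> e) f w = f w + e * f w'"
proof -
  let ?a = "\<lambda>e::int. act E (vertex X E v [^]\<^bsub>raag X E\<^esub> e)"
  interpret group "raag X E" by (rule group_presented_group)
  note c = gen_closed[OF v, of "commuting_relations E"]
  have up: "?a (e + 1) f = mul E v (?a e f)" for e f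
    using c v int_pow_mult[OF c, of 1 e] by (simp add: add.commute act_mult act_vertex)
  have down: "?a (e - 1) f = quot E v (?a e f)" for e f
    using c v int_pow_mult[OF c, of "-1" e] by (simp add: int_pow_neg act_mult act_inv_vertex)
  have 1: "?a e f w = f w" if "strip E v w = None" for w e
  proof (induction e rule: int_induct[where k = 0])
    case base
    then show ?case by (simp add: act_one)
  next
    case (step1 i)
    then show ?case using that by (simp add: up mul_def)
  next
    case (step2 i)
    then show ?case using that by (simp add: down quot.simps[of _ _ _ w])
  qed
  show "strip E v w = None \<Longrightarrow> ?a e f w = f w" by (rule 1)
  assume w: "strip E v w = Some w'" "strip E v w' = None"
  show "?a e f w = f w + e * f w'"
  proof (induction e rule: int_induct[where k = 0])
    case base
    then show ?case by (simp add: act_one)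
  next
    case (step1 i)
    then show ?case using w 1[OF w(2)] by (simp add: up mul_def distrib_right)
  next
    case (step2 i)
    then show ?case using w 1[OF w(2)]
      by (simp add: down quot.simps[of _ _ _ w] quot.simps[of _ _ _ w'] left_diff_distrib)
  qed
qed

text \<open>Words in which no two equal letters can be brought together by exchanging linked letters.\<close>

fun reduced :: "('x \<times> 'x) set \<Rightarrow> 'x list \<Rightarrow> bool" where
  "reduced E [] \<longleftrightarrow> True"
| "reduced E (v # w) \<longleftrightarrow> strip E v w = None \<and> reduced E w"

text \<open>Removing \<open>v\<close> cannot bring two equal letters \<open>y\<close> together: \<open>y\<close> stands before the removed \<open>v\<close> only if
it is linked to \<open>v\<close>, and then \<open>strip_commute\<close> allows the two letters to be stripped in either order.\<close>

lemma reduced_strip: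
  assumes "reduced E w" "strip E v w = Some w'"
  shows "reduced E w' \<and> strip E v w' = None"
  using assms
proof (induction w arbitrary: w')
  case (Cons y w)
  show ?case
  proof (cases "y = v")
    case False
    with Cons.prems obtain z where z: "linked E v y" "strip E v w = Some z" "w' = y # z"
      by (auto split: if_splits)
    then have "reduced E z" "strip E v z = None" using Cons by auto
    moreover have "strip E y z = None"
      using strip_commute[of v y E w] z Cons.prems False by auto
    ultimately show ?thesis using z False by simp
  qed (use Cons.prems in simp)
qed simp

lemma (in group) inv_commutes:
  assumes "a \<in> carrier G" "b \<in> carrier G" "a \<otimes> b = b \<otimes> a"
  shows "inv a \<otimes> b = b \<otimes> inv a"
proof -
  have "inv a \<otimes> b = inv a \<otimes> (b \<otimes> a) \<otimes> inv a"
    using assms(1,2) by (simp add: m_assoc)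
  also have "\<dots> = inv a \<otimes> (a \<otimes> b) \<otimes> inv a" using assms(3) by simp
  also have "\<dots> = b \<otimes> inv a" using assms(1,2) by (simp add: m_assoc[symmetric])
  finally show ?thesis .
qed

lemma (in group) int_pow_commute:
  assumes x: "x \<in> carrier G" "y \<in> carrier G" and comm: "x \<otimes> y = y \<otimes> x"
  shows "x [^] (k::int) \<otimes> y [^] (l::int) = y [^] l \<otimes> x [^] k"
proof -
  have pow: "a [^] (j::int) \<otimes> b = b \<otimes> a [^] j"
    if "a \<in> carrier G" "b \<in> carrier G" "a \<otimes> b = b \<otimes> a" for a b j
    using group_commutes_pow[OF that(3,1,2)] inv_commutes that(1,2) by (auto simp only: int_pow_def2 nat_pow_closed split: if_split)
  show ?thesis
    using x comm[symmetric] pow[of y x l] by (intro pow int_pow_closed) auto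
qed

definition syllables :: "'x set \<Rightarrow> ('x \<times> 'x) set \<Rightarrow> ('x \<times> int) list \<Rightarrow> 'x word set"
  where "syllables X E s = foldr (\<lambda>(v, e) g. vertex X E v [^]\<^bsub>raag X E\<^esub> e \<otimes>\<^bsub>raag X E\<^esub> g) s \<one>\<^bsub>raag X E\<^esub>"

lemma syllables_simps [simp]:
  "syllables X E [] = \<one>\<^bsub>raag X E\<^esub>"
  "syllables X E ((v, e) # s) = vertex X E v [^]\<^bsub>raag X E\<^esub> e \<otimes>\<^bsub>raag X E\<^esub> syllables X E s"
  by (simp_all add: syllables_def)

lemma syllables_closed:
  assumes "fst ` set s \<subseteq> X"
  shows "syllables X E s \<in> carrier (raag X E)"
proof -
  interpret group "raag X E" by (rule group_presented_group)
  show ?thesis using assms by (induction s) (auto simp: gen_closed)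
qed

abbreviation unit_series :: "'x list \<Rightarrow> int"
  where "unit_series w \<equiv> (if w = [] then 1 else 0)"

text \<open>Each syllable removes at most one letter from a reduced word, so fewer syllables than letters cannot
reduce it to the empty word, the only word where \<open>unit_series\<close> does not vanish.\<close>

lemma syllables_low_coefficient:
  assumes "fst ` set s \<subseteq> X" "reduced E w" "length s < length w"
  shows "act E (syllables X E s) unit_series w = 0"
  using assms
proof (induction s arbitrary: w)
  case Nil
  then show ?case by (auto simp: act_one)
next
  case (Cons p s)
  obtain v e where p: "p = (v, e)" by (cases p)
  interpret group "raag X E" by (rule group_presented_group)
  from Cons.prems p have v: "v \<in> X" "fst ` set s \<subseteq> X" by auto
  have F: "act E (syllables X E (p # s)) unit_series w
      = act E (vertex X E v [^]\<^bsub>raag X E\<^esub> e) (act E (syllables X E s) unit_series) w"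
    using v p by (simp add: act_mult syllables_closed gen_closed)
  show ?case
  proof (cases "strip E v w")
    case None
    then show ?thesis using F Cons v by (simp add: act_vertex_pow)
  next
    case (Some w')
    then have "reduced E w'" "strip E v w' = None" "length w = Suc (length w')"
      using reduced_strip[OF Cons.prems(2)] strip_length by auto
    then show ?thesis
      using F Cons v Some act_vertex_pow(2)[OF v(1) Some] by simp
  qed
qed

text \<open>At its own word a reduced product of syllables uses up exactly the linear term of
each power \<open>(1 + v)\<^sup>e\<close>; leaving out a syllable is excluded by \<open>syllables_low_coefficient\<close>.\<close>

lemma syllables_top_coefficient:
  assumes "fst ` set s \<subseteq> X" "reduced E (map fst s)"
  shows "act E (syllables X E s) unit_series (map fst s) = prod_list (map snd s)"
  using assms
proof (induction s)
  case Nil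
  then show ?case by (simp add: act_one)
next
  case (Cons p s)
  obtain v e where p: "p = (v, e)" by (cases p)
  interpret group "raag X E" by (rule group_presented_group)
  from Cons.prems p have v: "v \<in> X" "fst ` set s \<subseteq> X" "strip E v (map fst s) = None" by auto
  have "act E (syllables X E s) unit_series (v # map fst s) = 0"
    by (rule syllables_low_coefficient) (use Cons.prems p in auto)
  then show ?case
    using v p Cons act_vertex_pow(2)[OF v(1), of E "v # map fst s" "map fst s"]
    by (simp add: act_mult syllables_closed gen_closed)
qed

lemma syllables_strip:
  assumes "fst ` set s \<subseteq> X" "strip E v (map fst s) = Some w"
  shows "\<exists>e s'. (v, e) \<in> set s \<and> set s' \<subseteq> set s \<and> map fst s' = w \<and>
    syllables X E s = vertex X E v [^]\<^bsub>raag X E\<^esub> e \<otimes>\<^bsub>raag X E\<^esub> syllables X E s'"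
  using assms
proof (induction s arbitrary: w)
  case (Cons p s)
  obtain u d where p: "p = (u, d)" by (cases p)
  interpret group "raag X E" by (rule group_presented_group)
  show ?case
  proof (cases "u = v")
    case True
    with Cons.prems p show ?thesis by (intro exI[of _ d] exI[of _ s]) auto
  next
    case False
    with Cons.prems p obtain z where z: "linked E v u" "strip E v (map fst s) = Some z" "w = u # z"
      by (auto split: if_splits)
    then obtain e s' where s': "(v, e) \<in> set s" "set s' \<subseteq> set s" "map fst s' = z"
      "syllables X E s = vertex X E v [^]\<^bsub>raag X E\<^esub> e \<otimes>\<^bsub>raag X E\<^esub> syllables X E s'"
      using Cons by fastforce
    have X: "u \<in> X" "v \<in> X" using Cons.prems p s'(1) by force+
    have S: "syllables X E s' \<in> carrier (raag X E)"
      using s'(2) Cons.prems by (intro syllables_closed) auto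
    have comm: "vertex X E u [^]\<^bsub>raag X E\<^esub> d \<otimes>\<^bsub>raag X E\<^esub> vertex X E v [^]\<^bsub>raag X E\<^esub> e
        = vertex X E v [^]\<^bsub>raag X E\<^esub> e \<otimes>\<^bsub>raag X E\<^esub> vertex X E u [^]\<^bsub>raag X E\<^esub> d"
      using X z(1) vertex_commute[of u X v E]
      by (intro int_pow_commute) (auto simp: gen_closed)
    have "syllables X E (p # s)
        = vertex X E v [^]\<^bsub>raag X E\<^esub> e \<otimes>\<^bsub>raag X E\<^esub> syllables X E ((u, d) # s')"
      using p s'(4) X S comm by (simp add: gen_closed m_assoc[symmetric])
    then show ?thesis
      using s' z p by (intro exI[of _ e] exI[of _ "(u, d) # s'"]) auto
  qed
qed simp

text \<open>If the new power of \<open>v\<close> meets an old one, the two are merged at the front; the rest stays reduced by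
\<open>reduced_strip\<close> and contains no further \<open>v\<close> that could be merged.\<close>

lemma vertex_pow_mult_reduced:
  assumes "v \<in> X" "fst ` set s \<subseteq> X" "reduced E (map fst s)" "0 \<notin> snd ` set s"
  shows "\<exists>t. fst ` set t \<subseteq> X \<and> reduced E (map fst t) \<and> 0 \<notin> snd ` set t \<and>
    vertex X E v [^]\<^bsub>raag X E\<^esub> (d::int) \<otimes>\<^bsub>raag X E\<^esub> syllables X E s = syllables X E t"
proof -
  interpret group "raag X E" by (rule group_presented_group)
  have ex: ?thesis
    if "fst ` set s' \<subseteq> X" "reduced E (map fst s')" "0 \<notin> snd ` set s'" "strip E v (map fst s') = None"
      "vertex X E v [^]\<^bsub>raag X E\<^esub> d \<otimes>\<^bsub>raag X E\<^esub> syllables X E s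
        = vertex X E v [^]\<^bsub>raag X E\<^esub> (k::int) \<otimes>\<^bsub>raag X E\<^esub> syllables X E s'" for s' k
  proof (cases "k = 0")
    case True
    with that syllables_closed[OF that(1), of E] show ?thesis by (intro exI[of _ s']) simp
  next
    case False
    with that assms(1) show ?thesis by (intro exI[of _ "(v, k) # s'"]) simp
  qed
  show ?thesis
  proof (cases "strip E v (map fst s)")
    case None
    then show ?thesis using assms by (intro ex) auto
  next
    case (Some w)
    obtain e s' where s': "(v, e) \<in> set s" "set s' \<subseteq> set s" "map fst s' = w"
      "syllables X E s = vertex X E v [^]\<^bsub>raag X E\<^esub> e \<otimes>\<^bsub>raag X E\<^esub> syllables X E s'"
      using syllables_strip[OF assms(2) Some] by blast
    have X: "fst ` set s' \<subseteq> X" using s'(2) assms(2) by auto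
    have "vertex X E v [^]\<^bsub>raag X E\<^esub> d \<otimes>\<^bsub>raag X E\<^esub> syllables X E s
        = vertex X E v [^]\<^bsub>raag X E\<^esub> (d + e) \<otimes>\<^bsub>raag X E\<^esub> syllables X E s'"
      using s'(4) syllables_closed[OF X, of E] assms(1)
      by (simp add: int_pow_mult gen_closed m_assoc)
    then show ?thesis
      using reduced_strip[OF assms(3) Some] s' X assms(4) by (intro ex[of s' "d + e"]) auto
  qed
qed

lemma reduced_syllables_exist:
  assumes "g \<in> carrier (raag X E)"
  obtains s where "fst ` set s \<subseteq> X" "reduced E (map fst s)" "0 \<notin> snd ` set s" "g = syllables X E s"
proof -
  interpret group "raag X E" by (rule group_presented_group)
  have "\<exists>s. fst ` set s \<subseteq> X \<and> reduced E (map fst s) \<and> 0 \<notin> snd ` set s \<and> g = syllables X E s"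
    using assms
  proof (induction rule: presented_induct)
    case one
    then show ?case by (intro exI[of _ "[]"]) simp
  next
    case (gen x h)
    then show ?case using vertex_pow_mult_reduced[of x X _ E 1] by (auto simp: gen_closed)
  next
    case (inv_gen x h)
    then show ?case using vertex_pow_mult_reduced[of x X _ E "-1"]
      by (auto simp: gen_closed int_pow_neg)
  qed
  then show thesis using that by blast
qed

text \<open>An element that fixes the unit series has all nonconstant coefficients zero, whereas a
nonempty reduced product of nontrivial syllables has a nonzero one, the product of its exponents.\<close>

theorem act_faithful:
  assumes "g \<in> carrier (raag X E)" "act E g unit_series = unit_series"
  shows "g = \<one>\<^bsub>raag X E\<^esub>"
proof -
  obtain s where s: "fst ` set s \<subseteq> X" "reduced E (map fst s)" "0 \<notin> snd ` set s" "g = syllables X E s"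
    using assms(1) by (rule reduced_syllables_exist)
  have "s = []"
  proof (rule ccontr)
    assume "s \<noteq> []"
    then have "prod_list (map snd s) = 0"
      using syllables_top_coefficient[OF s(1,2)] s(4) assms(2) by simp
    then show False using s(3) by (auto simp: prod_list_zero_iff)
  qed
  then show ?thesis using s(4) by simp
qed

section \<open>Irreducible right-angled Artin groups\<close>

text \<open>The filtration by degree.  Elements that raise it by \<open>d\<close> are those congruent to \<open>1\<close> modulo
terms of degree \<open>d\<close>.\<close>

definition vanishes :: "nat \<Rightarrow> ('x list \<Rightarrow> int) \<Rightarrow> bool"
  where "vanishes m f \<longleftrightarrow> (\<forall>w. length w < m \<longrightarrow> f w = 0)"

definition raises :: "('x \<times> 'x) set \<Rightarrow> nat \<Rightarrow> 'x word set \<Rightarrow> bool"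
  where "raises E d g \<longleftrightarrow>
    (\<forall>m f. vanishes m f \<longrightarrow> vanishes (m + d) (\<lambda>w. act E g f w - f w))"

lemma quot_diff: "quot E v (\<lambda>w. f w - h w) w = quot E v f w - quot E v h w"
proof (induction w rule: length_induct)
  case (1 w)
  then show ?case
    by (auto simp: quot.simps[of E v _ w] dest: strip_length split: option.split)
qed

lemma act_word_diff: "act_word E u (\<lambda>w. f w - h w) = (\<lambda>w. act_word E u f w - act_word E u h w)"
proof (induction u)
  case (Cons p u)
  then show ?case
    by (cases p) (auto intro!: ext simp: quot_diff mul_def split: option.split)
qed simp

lemma act_diff:
  assumes "g \<in> carrier (raag X E)"
  shows "act E g (\<lambda>w. f w - h w) w = act E g f w - act E g h w"
  using assms by (auto elim!: presented_carrierE simp: act_class act_word_diff)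

lemma raises_mult:
  assumes "g \<in> carrier (raag X E)" "h \<in> carrier (raag X E)" "raises E d g" "raises E d h"
  shows "raises E d (g \<otimes>\<^bsub>raag X E\<^esub> h)"
  unfolding raises_def
proof (intro allI impI)
  fix m and f :: "'a list \<Rightarrow> int" assume f: "vanishes m f"
  then have h: "vanishes (m + d) (\<lambda>w. act E h f w - f w)"
    using assms(4) by (auto simp: raises_def)
  have "vanishes m (act E h f)"
    unfolding vanishes_def
  proof (intro allI impI)
    fix w :: "'a list" assume "length w < m"
    then have "act E h f w - f w = 0" "f w = 0" using h f by (auto simp: vanishes_def)
    then show "act E h f w = 0" by simp
  qed
  then have g: "vanishes (m + d) (\<lambda>w. act E g (act E h f) w - act E h f w)"
    using assms(3) by (auto simp: raises_def)
  show "vanishes (m + d) (\<lambda>w. act E (g \<otimes>\<^bsub>raag X E\<^esub> h) f w - f w)"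
    unfolding vanishes_def
  proof (intro allI impI)
    fix w :: "'a list" assume "length w < m + d"
    then have "act E g (act E h f) w - act E h f w = 0" "act E h f w - f w = 0"
      using g h by (auto simp: vanishes_def)
    then show "act E (g \<otimes>\<^bsub>raag X E\<^esub> h) f w - f w = 0"
      using assms(1,2) by (simp add: act_mult)
  qed
qed

lemma raises_vertex: "v \<in> X \<Longrightarrow> raises E 1 (vertex X E v)"
  by (auto simp: raises_def vanishes_def act_vertex mul_def dest: strip_length split: option.split)

lemma raises_inv_vertex:
  assumes "v \<in> X"
  shows "raises E 1 (inv\<^bsub>raag X E\<^esub> vertex X E v)"
proof -
  have q: "quot E v f w = 0" if f: "vanishes m f" and w: "length w < m" for f m w
    using w
  proof (induction w rule: length_induct)
    case (1 w)
    then show ?case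
      using f by (subst quot.simps) (auto simp: vanishes_def dest: strip_length split: option.split)
  qed
  have "quot E v f w - f w = 0" if f: "vanishes m f" and w: "length w < Suc m" for f m w
  proof (cases "strip E v w")
    case (Some w')
    with w have "length w' < m" using strip_length by fastforce
    from q[OF f this] Some show ?thesis by (simp add: quot.simps[of E v f w])
  qed (simp add: quot.simps[of E v f w])
  then show ?thesis
    using assms by (auto simp: raises_def vanishes_def act_inv_vertex)
qed

lemma raises_one: "g \<in> carrier (raag X E) \<Longrightarrow> raises E 1 g"
proof (induction rule: presented_induct)
  case one
  then show ?case by (simp add: raises_def act_one vanishes_def)
next
  case (gen x h)
  then show ?case by (intro raises_mult raises_vertex) auto
next
  case (inv_gen x h)
  interpret group "raag X E" by (rule group_presented_group)
  from inv_gen show ?case by (intro raises_mult raises_inv_vertex) auto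
qed

text \<open>With \<open>g = 1 + x\<close> and \<open>h = 1 + y\<close>, the product is \<open>1 + x + y + x y\<close>, and \<open>x y\<close> has degree at
least \<open>2 d > d\<close>.\<close>

lemma raises_additive:
  assumes g: "g \<in> carrier (raag X E)" "h \<in> carrier (raag X E)" "raises E d g" "raises E d h"
    and d: "d > 0" and f: "vanishes m f" and w: "length w \<le> m + d"
  shows "act E (g \<otimes>\<^bsub>raag X E\<^esub> h) f w - f w = (act E g f w - f w) + (act E h f w - f w)"
proof -
  let ?k = "\<lambda>w. act E h f w - f w"
  have "vanishes (m + d) ?k" using g(4) f by (simp add: raises_def)
  then have "vanishes (m + d + d) (\<lambda>w. act E g ?k w - ?k w)" using g(3) by (simp add: raises_def)
  then have "act E g ?k w = ?k w" using w d by (auto simp: vanishes_def)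
  then show ?thesis using g(1,2) by (simp add: act_mult act_diff[OF g(1)])
qed

text \<open>Suppose that all \<open>\<beta> g\<close> are congruent to \<open>1\<close> modulo degree \<open>d\<close>.  Then the
coefficients of \<open>\<beta> g\<close> in degree \<open>d\<close> are additive in \<open>g\<close>, hence determined by the exponent sums of \<open>g\<close>.
Since \<open>\<beta> g = \<beta> (\<beta> g)\<close>, they are equally determined by those of \<open>\<beta> g\<close>, which are zero.  So the
congruence improves to degree \<open>d + 1\<close>, and in the end \<open>\<beta> g\<close> acts trivially on the unit series.\<close>

lemma retraction_trivial:
  assumes hom: "\<beta> \<in> hom (raag X E) (raag X E)"
    and idem: "\<And>g. g \<in> carrier (raag X E) \<Longrightarrow> \<beta> (\<beta> g) = \<beta> g"
    and zero: "\<And>g v. g \<in> carrier (raag X E) \<Longrightarrow> v \<in> X \<Longrightarrow> exp_sum v (\<beta> g) = 0"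
    and g: "g \<in> carrier (raag X E)"
  shows "\<beta> g = \<one>\<^bsub>raag X E\<^esub>"
proof (rule act_faithful[of _ X E])
  have closed: "\<beta> g \<in> carrier (raag X E)" if "g \<in> carrier (raag X E)" for g
    using hom that by (auto simp: hom_def)
  have "\<forall>g\<in>carrier (raag X E). raises E (Suc d) (\<beta> g)" for d
  proof (induction d)
    case 0
    then show ?case using closed raises_one by simp blast
  next
    case (Suc d)
    have "act E (\<beta> g) f w - f w = 0"
      if g: "g \<in> carrier (raag X E)" and f: "vanishes m f" and w: "length w < m + Suc (Suc d)"
      for g m f w
    proof -
      let ?\<phi> = "\<lambda>g. act E (\<beta> g) f w - f w"
      have "?\<phi> (x \<otimes>\<^bsub>raag X E\<^esub> y) = ?\<phi> x + ?\<phi> y"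
        if "x \<in> carrier (raag X E)" "y \<in> carrier (raag X E)" for x y
        using that Suc closed f w by (simp add: hom_mult[OF hom] raises_additive[where d = "Suc d"])
      then obtain F where "F \<subseteq> X" "?\<phi> (\<beta> g) = (\<Sum>v\<in>F. exp_sum v (\<beta> g) * ?\<phi> (vertex X E v))"
        using additive_eq_exp_sums[of X E ?\<phi> "\<beta> g"] closed[OF g] by (metis (no_types, lifting) order_refl)
      moreover from \<open>F \<subseteq> X\<close> have "(\<Sum>v\<in>F. exp_sum v (\<beta> g) * ?\<phi> (vertex X E v)) = 0"
        by (intro sum.neutral) (auto simp: zero[OF g])
      ultimately show ?thesis using idem[OF g] by simp
    qed
    then show ?case by (simp add: raises_def vanishes_def)
  qed
  then have r: "raises E (Suc d) (\<beta> g)" for d using g by blast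
  show "act E (\<beta> g) unit_series = unit_series"
  proof
    fix w :: "'a list"
    have "vanishes 0 (unit_series :: 'a list \<Rightarrow> int)" by (simp add: vanishes_def)
    with r[of "length w"] have "vanishes (0 + Suc (length w)) (\<lambda>w. act E (\<beta> g) unit_series w - unit_series w)"
      unfolding raises_def by blast
    then have "act E (\<beta> g) unit_series w - unit_series w = 0" unfolding vanishes_def by simp
    then show "act E (\<beta> g) unit_series w = unit_series w" by simp
  qed
  show "\<beta> g \<in> carrier (raag X E)" using closed g by blast
qed

definition noncommuting :: "'x set \<Rightarrow> ('x \<times> 'x) set \<Rightarrow> ('x \<times> 'x) set"
  where "noncommuting X E = {(u, v). u \<in> X \<and> v \<in> X \<and> u \<noteq> v \<and> \<not> linked E u v}"

text \<open>The two projections of an internal direct product decomposition, regarded as endomorphisms.\<close>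

locale raag_splitting =
  fixes X :: "'x set" and E and \<alpha> \<beta>
  assumes hom: "\<alpha> \<in> hom (raag X E) (raag X E)" "\<beta> \<in> hom (raag X E) (raag X E)"
    and idem: "\<And>g. g \<in> carrier (raag X E) \<Longrightarrow> \<alpha> (\<alpha> g) = \<alpha> g" "\<And>g. g \<in> carrier (raag X E) \<Longrightarrow> \<beta> (\<beta> g) = \<beta> g"
    and comm: "\<And>g h. g \<in> carrier (raag X E) \<Longrightarrow> h \<in> carrier (raag X E) \<Longrightarrow>
      \<alpha> g \<otimes>\<^bsub>raag X E\<^esub> \<beta> h = \<beta> h \<otimes>\<^bsub>raag X E\<^esub> \<alpha> g"
    and split: "\<And>g. g \<in> carrier (raag X E) \<Longrightarrow> \<alpha> g \<otimes>\<^bsub>raag X E\<^esub> \<beta> g = g"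
begin

lemma closed:
  "g \<in> carrier (raag X E) \<Longrightarrow> \<alpha> g \<in> carrier (raag X E)"
  "g \<in> carrier (raag X E) \<Longrightarrow> \<beta> g \<in> carrier (raag X E)"
  using hom by (auto simp: hom_def)

lemma swap: "raag_splitting X E \<beta> \<alpha>"
  using hom idem comm split by unfold_locales metis+

definition kills :: "('x word set \<Rightarrow> 'x word set) \<Rightarrow> 'x \<Rightarrow> bool"
  where "kills \<gamma> v \<longleftrightarrow> (\<forall>g\<in>carrier (raag X E). exp_sum v (\<gamma> g) = 0)"

lemma exp_sum_split:
  "g \<in> carrier (raag X E) \<Longrightarrow> exp_sum v (\<alpha> g) + exp_sum v (\<beta> g) = exp_sum v g"
  using split[of g] exp_sum_mult[OF closed, of g g v] by simp

lemma not_kills_both: "v \<in> X \<Longrightarrow> \<not> (kills \<alpha> v \<and> kills \<beta> v)"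
  using exp_sum_split[of "vertex X E v" v] exp_sum_vertex[of v X v E]
  by (force simp: kills_def gen_closed)

text \<open>The exponent vectors of \<open>\<alpha> g\<close> and \<open>\<beta> h\<close> at the coordinates \<open>u\<close>, \<open>v\<close> are always linearly dependent.
If both kinds include a nonzero vector, then all vectors of both kinds lie on one line.  But
the sums \<open>\<alpha> g \<otimes> \<beta> g = g\<close> attain both unit vectors.\<close>

lemma kills_edge:
  assumes uv: "(u, v) \<in> noncommuting X E"
  shows "kills \<alpha> u \<and> kills \<alpha> v \<or> kills \<beta> u \<and> kills \<beta> v"
proof (rule ccontr)
  assume neg: "\<not> ?thesis"
  from uv have X: "u \<in> X" "v \<in> X" "u \<noteq> v" by (auto simp: noncommuting_def)
  have par: "exp_sum u (\<alpha> g) * exp_sum v (\<beta> h) = exp_sum v (\<alpha> g) * exp_sum u (\<beta> h)"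
    if "g \<in> carrier (raag X E)" "h \<in> carrier (raag X E)" for g h
    using uv that comm closed
    by (intro commuting_elements_exp_sums[of u v E _ X]) (auto simp: noncommuting_def)
  obtain g where g: "g \<in> carrier (raag X E)" "exp_sum u (\<alpha> g) \<noteq> 0 \<or> exp_sum v (\<alpha> g) \<noteq> 0"
    using neg by (auto simp: kills_def)
  obtain h where h: "h \<in> carrier (raag X E)" "exp_sum u (\<beta> h) \<noteq> 0 \<or> exp_sum v (\<beta> h) \<noteq> 0"
    using neg by (auto simp: kills_def)
  define p q r s where "p = exp_sum u (\<alpha> g)" "q = exp_sum v (\<alpha> g)"
    "r = exp_sum u (\<beta> h)" "s = exp_sum v (\<beta> h)"
  have nz: "p \<noteq> 0 \<or> q \<noteq> 0" "r \<noteq> 0 \<or> s \<noteq> 0" using g h by (auto simp: p_q_r_s_def)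
  have ps: "p * s = q * r" using par g h by (simp add: p_q_r_s_def)
  \<comment> \<open>All exponent vectors at the two coordinates are multiples of \<open>(p, q)\<close>.\<close>
  have main: "p * exp_sum v x = q * exp_sum u x" if x: "x \<in> carrier (raag X E)" for x
  proof -
    have b: "p * exp_sum v (\<beta> x) = q * exp_sum u (\<beta> x)" using par g x by (simp add: p_q_r_s_def)
    have a: "exp_sum u (\<alpha> x) * s = exp_sum v (\<alpha> x) * r" using par h x by (simp add: p_q_r_s_def)
    have "p * exp_sum v (\<alpha> x) = q * exp_sum u (\<alpha> x)"
    proof (cases "r = 0")
      case True
      with nz ps a show ?thesis by simp
    next
      case False
      have "(p * exp_sum v (\<alpha> x)) * r = (q * exp_sum u (\<alpha> x)) * r"
        using a ps by (metis mult.assoc mult.commute)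
      with False show ?thesis by simp
    qed
    then show ?thesis using b exp_sum_split[OF x, symmetric] by (simp add: distrib_left)
  qed
  have "p = 0" "q = 0"
    using main[of "vertex X E v"] main[of "vertex X E u"] X
    by (simp_all add: gen_closed exp_sum_vertex)
  with nz show False by simp
qed

text \<open>On an infinite cyclic group \<open>\<alpha>\<close> is multiplication by an idempotent integer \<open>m\<close>.\<close>

lemma kills_isolated:
  assumes X: "X = {v}"
  shows "kills \<alpha> v \<or> kills \<beta> v"
proof -
  let ?\<phi> = "\<lambda>g. exp_sum v (\<alpha> g)"
  define m where "m = ?\<phi> (vertex X E v)"
  have v: "vertex X E v \<in> carrier (raag X E)" using X by (auto intro: gen_closed)
  have add: "?\<phi> (g \<otimes>\<^bsub>raag X E\<^esub> h) = ?\<phi> g + ?\<phi> h"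
    if "g \<in> carrier (raag X E)" "h \<in> carrier (raag X E)" for g h
    using that closed by (simp add: hom_mult[OF hom(1)] exp_sum_mult)
  have eq: "?\<phi> g = exp_sum v g * m" if g: "g \<in> carrier (raag X E)" for g
  proof -
    show ?thesis
    proof (rule additive_eq_exp_sums[of X E ?\<phi> g, OF add g])
      fix F assume "F \<subseteq> X"
        "\<And>F'. finite F' \<Longrightarrow> F \<subseteq> F' \<Longrightarrow> ?\<phi> g = (\<Sum>x\<in>F'. exp_sum x g * ?\<phi> (vertex X E x))"
      from this(2)[of X] this(1) X show ?thesis by (simp add: m_def)
    qed
  qed
  have "m = m * m"
    using eq[OF closed(1)[OF v]] idem(1)[OF v] by (simp add: m_def)
  then consider "m = 0" | "m = 1" by auto
  then show ?thesis
  proof cases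
    case 1
    then show ?thesis using eq by (simp add: kills_def)
  next
    case 2
    have "exp_sum v (\<beta> g) = 0" if "g \<in> carrier (raag X E)" for g
      using exp_sum_split[OF that, of v] eq[OF that] 2 by simp
    then show ?thesis by (simp add: kills_def)
  qed
qed

lemma factor_trivial:
  assumes "\<And>v. v \<in> X \<Longrightarrow> kills \<alpha> v" "g \<in> carrier (raag X E)"
  shows "\<alpha> g = \<one>\<^bsub>raag X E\<^esub>"
  using assms by (intro retraction_trivial[OF hom(1) idem(1)]) (auto simp: kills_def)

text \<open>Along an edge of the noncommuting graph the same projection kills both ends, because the
two projections never kill a common vertex.\<close>

lemma kills_spread:
  assumes conn: "\<And>u v. u \<in> X \<Longrightarrow> v \<in> X \<Longrightarrow> (u, v) \<in> (noncommuting X E)\<^sup>*"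
    and u: "u \<in> X" "kills \<alpha> u" and v: "v \<in> X"
  shows "kills \<alpha> v"
  using conn[OF u(1) v]
proof (induction rule: rtrancl_induct)
  case base
  show ?case by (rule u)
next
  case (step y z)
  from step.hyps(2) have "y \<in> X" by (auto simp: noncommuting_def)
  then show ?case using kills_edge[OF step.hyps(2)] not_kills_both step.IH by blast
qed

end

lemma raag_splitting_trivial:
  assumes "raag_splitting X E \<alpha> \<beta>"
    and conn: "\<And>u v. u \<in> X \<Longrightarrow> v \<in> X \<Longrightarrow> (u, v) \<in> (noncommuting X E)\<^sup>*"
  shows "(\<forall>g\<in>carrier (raag X E). \<alpha> g = \<one>\<^bsub>raag X E\<^esub>) \<or>
    (\<forall>g\<in>carrier (raag X E). \<beta> g = \<one>\<^bsub>raag X E\<^esub>)"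
proof -
  interpret A: raag_splitting X E \<alpha> \<beta> by fact
  interpret B: raag_splitting X E \<beta> \<alpha> by (rule A.swap)
  show ?thesis
  proof (cases "X = {}")
    case True
    then show ?thesis using A.factor_trivial by simp
  next
    case False
    then obtain u where u: "u \<in> X" by blast
    have "A.kills \<alpha> u \<or> A.kills \<beta> u"
    proof (cases "X = {u}")
      case True
      then show ?thesis by (rule A.kills_isolated)
    next
      case False
      with u obtain v where "v \<in> X" "v \<noteq> u" by blast
      with conn[of u v] u obtain w where "(u, w) \<in> noncommuting X E"
        by (auto elim: converse_rtranclE)
      from A.kills_edge[OF this] show ?thesis by blast
    qed
    then show ?thesis
      using A.kills_spread[OF conn u] B.kills_spread[OF conn u] A.factor_trivial B.factor_trivial
      by metis
  qed
qed

text \<open>For any decomposition, connectedness of the noncommuting graph forces one projection to be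
zero in the abelianization, and then it is trivial by \<open>retraction_trivial\<close>.\<close>

theorem raag_irreducible:
  fixes H :: "('b, 'm) monoid_scheme" and K :: "('c, 'n) monoid_scheme"
  assumes conn: "\<And>u v. u \<in> X \<Longrightarrow> v \<in> X \<Longrightarrow> (u, v) \<in> (noncommuting X E)\<^sup>*"
    and H: "group H" and K: "group K" and iso: "raag X E \<cong> H \<times>\<times> K"
  shows "trivial_group H \<or> trivial_group K"
proof -
  interpret H: group H by fact
  interpret K: group K by fact
  interpret G: group "raag X E" by (rule group_presented_group)
  interpret HK: group "H \<times>\<times> K" by (rule DirProd_group[OF H K])
  obtain \<phi> where \<phi>: "\<phi> \<in> iso (raag X E) (H \<times>\<times> K)" using iso by (auto simp: is_iso_def)
  define \<psi> where "\<psi> = inv_into (carrier (raag X E)) \<phi>"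
  have \<psi>: "\<psi> \<in> iso (H \<times>\<times> K) (raag X E)"
    unfolding \<psi>_def by (rule G.iso_set_sym[OF \<phi>])
  have \<phi>\<psi>: "\<phi> (\<psi> x) = x" if "x \<in> carrier (H \<times>\<times> K)" for x
    using \<phi> that unfolding \<psi>_def iso_def bij_betw_def by (auto intro: f_inv_into_f)
  have \<psi>\<phi>: "\<psi> (\<phi> g) = g" if "g \<in> carrier (raag X E)" for g
    using \<phi> that unfolding \<psi>_def iso_def bij_betw_def by auto
  have h\<phi>: "\<phi> \<in> hom (raag X E) (H \<times>\<times> K)" and h\<psi>: "\<psi> \<in> hom (H \<times>\<times> K) (raag X E)"
    using \<phi> \<psi> by (auto simp: iso_def)
  define \<alpha> where "\<alpha> g = \<psi> (fst (\<phi> g), \<one>\<^bsub>K\<^esub>)" for g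
  define \<beta> where "\<beta> g = \<psi> (\<one>\<^bsub>H\<^esub>, snd (\<phi> g))" for g
  have c: "fst (\<phi> g) \<in> carrier H" "snd (\<phi> g) \<in> carrier K" if "g \<in> carrier (raag X E)" for g
    using hom_in_carrier[OF h\<phi> that] by (auto simp: mem_Times_iff)
  have m: "\<psi> (a, b) \<otimes>\<^bsub>raag X E\<^esub> \<psi> (a', b') = \<psi> (a \<otimes>\<^bsub>H\<^esub> a', b \<otimes>\<^bsub>K\<^esub> b')"
    if "a \<in> carrier H" "a' \<in> carrier H" "b \<in> carrier K" "b' \<in> carrier K" for a a' b b'
    using that hom_mult[OF h\<psi>, of "(a, b)" "(a', b')"] by simp
  have cl: "\<psi> (a, b) \<in> carrier (raag X E)" if "a \<in> carrier H" "b \<in> carrier K" for a b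
    using hom_in_carrier[OF h\<psi>, of "(a, b)"] that by simp
  have \<phi>m: "\<phi> (g \<otimes>\<^bsub>raag X E\<^esub> h) = (fst (\<phi> g) \<otimes>\<^bsub>H\<^esub> fst (\<phi> h), snd (\<phi> g) \<otimes>\<^bsub>K\<^esub> snd (\<phi> h))"
    if "g \<in> carrier (raag X E)" "h \<in> carrier (raag X E)" for g h
    using hom_mult[OF h\<phi> that] by (simp add: mult_DirProd')
  have "raag_splitting X E \<alpha> \<beta>"
    by unfold_locales (auto intro!: homI simp: \<alpha>_def \<beta>_def m c cl \<phi>m \<phi>\<psi> \<psi>\<phi>)
  from raag_splitting_trivial[OF this conn]
  consider "\<And>g. g \<in> carrier (raag X E) \<Longrightarrow> \<alpha> g = \<one>\<^bsub>raag X E\<^esub>"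
    | "\<And>g. g \<in> carrier (raag X E) \<Longrightarrow> \<beta> g = \<one>\<^bsub>raag X E\<^esub>" by blast
  then show ?thesis
  proof cases
    case 1
    have "h = \<one>\<^bsub>H\<^esub>" if "h \<in> carrier H" for h
    proof -
      have "\<psi> (h, \<one>\<^bsub>K\<^esub>) = \<one>\<^bsub>raag X E\<^esub>"
        using 1[OF cl[OF that K.one_closed]] that by (simp add: \<alpha>_def \<phi>\<psi>)
      then show ?thesis using \<phi>\<psi>[of "(h, \<one>\<^bsub>K\<^esub>)"] that hom_one[OF h\<phi> G.group_axioms HK.group_axioms] by simp
    qed
    then show ?thesis using H.trivial_group_subset by blast
  next
    case 2
    have "k = \<one>\<^bsub>K\<^esub>" if "k \<in> carrier K" for k
    proof -
      have "\<psi> (\<one>\<^bsub>H\<^esub>, k) = \<one>\<^bsub>raag X E\<^esub>"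
        using 2[OF cl[OF H.one_closed that]] that by (simp add: \<beta>_def \<phi>\<psi>)
      then show ?thesis using \<phi>\<psi>[of "(\<one>\<^bsub>H\<^esub>, k)"] that hom_one[OF h\<phi> G.group_axioms HK.group_axioms] by simp
    qed
    then show ?thesis using K.trivial_group_subset by blast
  qed
qed

section \<open>Permutations as products of adjacent transpositions\<close>

definition adj_perm :: "nat list \<Rightarrow> nat \<Rightarrow> nat"
  where "adj_perm xs = foldr (\<lambda>i f. transpose i (i + 1) \<circ> f) xs id"

lemma adj_perm_simps [simp]:
  "adj_perm [] = id"
  "adj_perm (i # xs) = transpose i (i + 1) \<circ> adj_perm xs"
  by (simp_all add: adj_perm_def)

lemma adj_perm_append: "adj_perm (xs @ ys) = adj_perm xs \<circ> adj_perm ys"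
  by (induction xs) (auto simp: fun_eq_iff)

lemma adj_perm_permutes: "set xs \<subseteq> {a..<b} \<Longrightarrow> adj_perm xs permutes {a..b}"
  by (induction xs) (auto intro!: permutes_compose permutes_swap_id permutes_id simp del: One_nat_def)

lemma adj_perm_rev: "adj_perm (rev xs) \<circ> adj_perm xs = id"
  by (induction xs) (auto simp: adj_perm_append fun_eq_iff)

lemma adj_perm_upt: "k \<le> b \<Longrightarrow> adj_perm [k..<b] b = k"
  by (induction k rule: inc_induct) (auto simp: upt_conv_Cons)

text \<open>The largest point \<open>b\<close> is brought to its image \<open>k\<close> by the cycle of \<open>[k..<b]\<close>; what remains fixes \<open>b\<close>.\<close>

lemma adj_perm_exists:
  assumes "\<sigma> permutes {a..b}"
  shows "\<exists>xs. set xs \<subseteq> {a..<b} \<and> adj_perm xs = \<sigma>"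
  using assms
proof (induction b arbitrary: \<sigma>)
  case 0
  then have "\<sigma> = id" by (cases "a = 0") (auto simp: permutes_empty)
  then show ?case by (intro exI[of _ "[]"]) simp
next
  case (Suc b)
  show ?case
  proof (cases "a \<le> Suc b")
    case False
    then have "\<sigma> = id" using Suc.prems by simp
    then show ?thesis by (intro exI[of _ "[]"]) simp
  next
    case True
    define k where "k = \<sigma> (Suc b)"
    have k: "k \<in> {a..Suc b}" using permutes_in_image[OF Suc.prems, of "Suc b"] True by (simp add: k_def)
    define zs where "zs = [k..<Suc b]"
    have zs: "set zs \<subseteq> {a..<Suc b}" using k by (auto simp: zs_def)
    define \<tau> where "\<tau> = adj_perm (rev zs) \<circ> \<sigma>"
    have "\<tau> permutes {a..Suc b}"
      unfolding \<tau>_def using zs by (intro permutes_compose Suc.prems adj_perm_permutes) simp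
    moreover have "\<tau> (Suc b) = Suc b"
      using fun_cong[OF adj_perm_rev[of zs], of "Suc b"] k adj_perm_upt[of k "Suc b"]
      by (simp add: \<tau>_def zs_def k_def[symmetric] del: upt_Suc)
    ultimately have "\<tau> permutes {a..b}"
      by (elim permutes_superset) (auto simp: le_Suc_eq)
    from Suc.IH[OF this] obtain ys where ys: "set ys \<subseteq> {a..<b}" "adj_perm ys = \<tau>" by blast
    have "adj_perm (zs @ ys) = \<sigma>"
      using adj_perm_rev[of "rev zs"] by (simp add: adj_perm_append ys(2) \<tau>_def o_assoc)
    then show ?thesis using zs ys by (intro exI[of _ "zs @ ys"]) auto
  qed
qed

text \<open>The values are corrected one at a time by a transposition that moves none of the values already right.\<close>

lemma permutation_with_values:
  assumes "distinct xs" "distinct ys" "length xs = length ys" "set xs \<subseteq> A" "set ys \<subseteq> A"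
  shows "\<exists>\<sigma>. \<sigma> permutes A \<and> map \<sigma> xs = ys"
  using assms
proof (induction xs arbitrary: ys)
  case Nil
  then show ?case by simp (rule exI, rule permutes_id)
next
  case (Cons x xs)
  then obtain y zs where ys: "ys = y # zs" by (cases ys) auto
  obtain \<sigma> where \<sigma>: "\<sigma> permutes A" "map \<sigma> xs = zs"
    using Cons.IH[of zs] Cons.prems ys by auto
  have "\<sigma> x \<in> A" using \<sigma>(1) Cons.prems by (simp add: permutes_in_image)
  then have "transpose (\<sigma> x) y \<circ> \<sigma> permutes A"
    using \<sigma>(1) Cons.prems ys by (intro permutes_compose permutes_swap_id) auto
  moreover have "transpose (\<sigma> x) y (\<sigma> z) = \<sigma> z" if "z \<in> set xs" for z
  proof -
    have "\<sigma> z \<noteq> \<sigma> x" using that Cons.prems permutes_inj[OF \<sigma>(1)] by (auto dest: injD)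
    moreover have "\<sigma> z \<noteq> y" using that Cons.prems ys \<sigma>(2) by auto
    ultimately show ?thesis by (simp add: transpose_def)
  qed
  then have "map (transpose (\<sigma> x) y \<circ> \<sigma>) (x # xs) = ys"
    using \<sigma>(2) ys by auto
  ultimately show ?case by blast
qed

section \<open>The Coxeter presentation of the symmetric group\<close>

abbreviation far :: "nat \<Rightarrow> nat \<Rightarrow> bool"
  where "far i j \<equiv> i + 2 \<le> j \<or> j + 2 \<le> i"

locale coxeter_generators = group G for G (structure) +
  fixes r :: "nat \<Rightarrow> 'a" and n :: nat
  assumes r_closed: "i \<in> {1..<n} \<Longrightarrow> r i \<in> carrier G"
    and r_square: "i \<in> {1..<n} \<Longrightarrow> r i \<otimes> r i = \<one>"
    and r_commute: "i \<in> {1..<n} \<Longrightarrow> j \<in> {1..<n} \<Longrightarrow> far i j \<Longrightarrow> r i \<otimes> r j = r j \<otimes> r i"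
    and r_braid: "1 \<le> i \<Longrightarrow> i + 1 < n \<Longrightarrow> r i \<otimes> r (i + 1) \<otimes> r i = r (i + 1) \<otimes> r i \<otimes> r (i + 1)"
begin

definition r_prod :: "nat list \<Rightarrow> 'a"
  where "r_prod xs = foldr (\<lambda>i g. r i \<otimes> g) xs \<one>"

lemma r_prod_simps [simp]: "r_prod [] = \<one>" "r_prod (i # xs) = r i \<otimes> r_prod xs"
  by (simp_all add: r_prod_def)

lemma r_prod_closed: "set xs \<subseteq> {1..<n} \<Longrightarrow> r_prod xs \<in> carrier G"
  by (induction xs) (auto simp: r_closed)

lemma r_prod_append:
  "set xs \<subseteq> {1..<n} \<Longrightarrow> set ys \<subseteq> {1..<n} \<Longrightarrow> r_prod (xs @ ys) = r_prod xs \<otimes> r_prod ys"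
  by (induction xs) (auto simp: r_closed r_prod_closed m_assoc)

text \<open>Rewriting must be followed simultaneously in \<open>G\<close> and in the symmetric group, because the normal form
of a word is identified through its permutation.\<close>

definition same :: "nat list \<Rightarrow> nat list \<Rightarrow> bool"
  where "same xs ys \<longleftrightarrow> set xs \<subseteq> {1..<n} \<and> set ys \<subseteq> {1..<n} \<and>
    r_prod xs = r_prod ys \<and> adj_perm xs = adj_perm ys"

lemma same_refl: "set xs \<subseteq> {1..<n} \<Longrightarrow> same xs xs"
  by (simp add: same_def)

lemma same_trans [trans]: "same xs ys \<Longrightarrow> same ys zs \<Longrightarrow> same xs zs"
  by (simp add: same_def)

lemma same_append: "same xs xs' \<Longrightarrow> same ys ys' \<Longrightarrow> same (xs @ ys) (xs' @ ys')"
  by (simp add: same_def r_prod_append adj_perm_append)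

lemma same_context:
  assumes "same xs ys" "set us \<subseteq> {1..<n}" "set vs \<subseteq> {1..<n}"
  shows "same (us @ xs @ vs) (us @ ys @ vs)"
  using assms by (intro same_append same_refl)

lemma same_square: "i \<in> {1..<n} \<Longrightarrow> same [i, i] []"
  by (auto simp: same_def r_closed r_square)

lemma same_braid: "1 \<le> i \<Longrightarrow> i + 1 < n \<Longrightarrow> same [i + 1, i, i + 1] [i, i + 1, i]"
  using r_braid[of i] by (auto simp: same_def r_closed m_assoc fun_eq_iff transpose_def)

lemma same_commute:
  assumes "i \<in> {1..<n}" "set xs \<subseteq> {1..<n}" "\<And>j. j \<in> set xs \<Longrightarrow> far i j"
  shows "same (i # xs) (xs @ [i])"
  using assms(2,3)
proof (induction xs)
  case Nil
  then show ?case using assms(1) by (simp add: same_def)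
next
  case (Cons j xs)
  then have j: "j \<in> {1..<n}" "far i j" by auto
  have "same [i, j] [j, i]"
    using assms(1) j r_commute[of i j] by (auto simp: same_def r_closed fun_eq_iff transpose_def)
  from same_context[OF this, of "[]" xs] have "same (i # j # xs) ([j] @ (i # xs) @ [])"
    using Cons.prems by simp
  also have "same \<dots> ([j] @ (xs @ [i]) @ [])"
    using Cons j by (intro same_context) auto
  finally show ?case by simp
qed

text \<open>The cosets of the subgroup generated by the first \<open>m - 1\<close> generators are represented by the
products of the intervals \<open>[k..<Suc m]\<close>: left multiplication by a generator \<open>i\<close> either changes \<open>k\<close> by
one (\<open>i = k - 1\<close> or \<open>i = k\<close>) or passes through the interval, unchanged if \<open>i < k - 1\<close>
and turned into \<open>i - 1\<close> by one braid relation if \<open>i > k\<close>.\<close>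

lemma normal_form:
  assumes "m < n" "set xs \<subseteq> {1..m}"
  shows "\<exists>k ys. 1 \<le> k \<and> k \<le> Suc m \<and> set ys \<subseteq> {1..<m} \<and> same xs ([k..<Suc m] @ ys)"
  using assms(2)
proof (induction xs)
  case Nil
  then show ?case by (intro exI[of _ "Suc m"] exI[of _ "[]"]) (simp add: same_refl)
next
  case (Cons i xs)
  then obtain k ys where k: "1 \<le> k" "k \<le> Suc m" and ys: "set ys \<subseteq> {1..<m}"
    and xs: "same xs ([k..<Suc m] @ ys)" by auto
  have ys': "set ys \<subseteq> {1..<n}" using ys assms(1) by auto
  have i: "1 \<le> i" "i \<le> m" "i \<in> {1..<n}" using Cons.prems assms(1) by auto
  have step: "same (i # xs) (i # [k..<Suc m] @ ys)"
    using same_append[OF same_refl[of "[i]"] xs] i by simp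
  consider "i + 1 < k" | "i + 1 = k" | "i = k" | "k < i" by linarith
  then show ?case
  proof cases
    case 1
    have "same (i # [k..<Suc m]) ([k..<Suc m] @ [i])"
      using 1 i k assms(1) by (intro same_commute) auto
    from same_context[OF this, of "[]" ys] have "same (i # [k..<Suc m] @ ys) ([k..<Suc m] @ (i # ys))"
      using ys' by simp
    with step have "same (i # xs) ([k..<Suc m] @ (i # ys))" by (rule same_trans)
    then show ?thesis using 1 k i ys by (intro exI[of _ k] exI[of _ "i # ys"]) auto
  next
    case 2
    then have "[i..<Suc m] = i # [k..<Suc m]" using i by (simp add: upt_conv_Cons)
    with step have "same (i # xs) ([i..<Suc m] @ ys)" by simp
    then show ?thesis using i ys by (intro exI[of _ i] exI[of _ ys]) auto
  next
    case 3
    note step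
    also have "i # [k..<Suc m] @ ys = [] @ [k, k] @ ([Suc k..<Suc m] @ ys)"
      using 3 i by (simp add: upt_conv_Cons)
    also have "same \<dots> ([] @ [] @ ([Suc k..<Suc m] @ ys))"
      using 3 i k ys' assms(1) by (intro same_context same_square) auto
    finally have "same (i # xs) ([Suc k..<Suc m] @ ys)" by simp
    then show ?thesis using 3 i ys by (intro exI[of _ "Suc k"] exI[of _ ys]) auto
  next
    case 4
    define j where "j = i - 1"
    have j: "i = Suc j" "k \<le> j" using 4 by (auto simp: j_def)
    have eq: "[k..<Suc m] = [k..<j] @ [j, Suc j] @ [Suc (Suc j)..<Suc m]"
    proof -
      have "[k..<Suc m] = [k..<j] @ [j..<Suc m]" using j i upt_add_eq_append[of k j "Suc m - j"] by simp
      moreover have "[j..<Suc m] = j # Suc j # [Suc (Suc j)..<Suc m]"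
        using j i by (simp add: upt_conv_Cons)
      ultimately show ?thesis by simp
    qed
    let ?A = "[k..<j]" and ?B = "[Suc (Suc j)..<Suc m]"
    have A: "set ?A \<subseteq> {1..<n}" and B: "set ?B \<subseteq> {1..<n}"
      using j i k assms(1) by auto
    have jn: "j \<in> {1..<n}" "Suc j \<in> {1..<n}" using j i k by auto
    note step
    also have "i # [k..<Suc m] @ ys = [] @ (i # ?A) @ ([j, Suc j] @ ?B @ ys)"
      using eq by simp
    also have "same \<dots> ([] @ (?A @ [i]) @ ([j, Suc j] @ ?B @ ys))"
      using A B jn ys' i j by (intro same_context same_commute) auto
    also have "\<dots> = ?A @ [j + 1, j, j + 1] @ (?B @ ys)" using j by simp
    also have "same \<dots> (?A @ [j, j + 1, j] @ (?B @ ys))"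
      using A B jn ys' by (intro same_context same_braid) auto
    also have "\<dots> = (?A @ [j, Suc j]) @ (j # ?B) @ ys" by simp
    also have "same \<dots> ((?A @ [j, Suc j]) @ (?B @ [j]) @ ys)"
      using A B jn ys' by (intro same_context same_commute) auto
    also have "\<dots> = [k..<Suc m] @ (j # ys)" using eq by simp
    finally show ?thesis using k j i ys by (intro exI[of _ k] exI[of _ "j # ys"]) auto
  qed
qed

text \<open>In the normal form the permutation sends \<open>Suc m\<close> to \<open>k\<close>; if it is the identity, the interval
is empty and the word involves fewer generators.\<close>

lemma r_prod_trivial:
  assumes "m < n" "set xs \<subseteq> {1..m}" "adj_perm xs = id"
  shows "r_prod xs = \<one>"
  using assms
proof (induction m arbitrary: xs)
  case 0
  then show ?case by simp
next
  case (Suc m)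
  obtain k ys where k: "1 \<le> k" "k \<le> Suc (Suc m)" and ys: "set ys \<subseteq> {1..<Suc m}"
    and xs: "same xs ([k..<Suc (Suc m)] @ ys)" using normal_form[OF Suc.prems(1,2)] by blast
  have "adj_perm ys (Suc (Suc m)) = Suc (Suc m)"
    using adj_perm_permutes[OF ys] by (rule permutes_not_in) simp
  then have "adj_perm xs (Suc (Suc m)) = k"
    using xs k(2) adj_perm_upt[of k "Suc (Suc m)"] by (simp add: same_def adj_perm_append del: upt_Suc)
  then have "k = Suc (Suc m)" using Suc.prems(3) by simp
  with xs have "r_prod xs = r_prod ys" "adj_perm xs = adj_perm ys" by (simp_all add: same_def)
  moreover have "set ys \<subseteq> {1..m}" using ys by auto
  ultimately show ?case using Suc.IH[of ys] Suc.prems by simp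
qed

lemma r_prod_rev: "set xs \<subseteq> {1..<n} \<Longrightarrow> r_prod (rev xs) = inv (r_prod xs)"
proof (induction xs)
  case (Cons i xs)
  then have i: "i \<in> {1..<n}" "set xs \<subseteq> {1..<n}" by auto
  then have "r i = inv (r i)" using r_closed r_square by (intro inv_equality[symmetric]) auto
  with Cons i show ?case by (simp add: r_prod_append r_prod_closed r_closed inv_mult_group)
qed simp

lemma r_prod_eqI:
  assumes "set xs \<subseteq> {1..<n}" "set ys \<subseteq> {1..<n}" "adj_perm xs = adj_perm ys"
  shows "r_prod xs = r_prod ys"
proof -
  have "r_prod (rev ys @ xs) = \<one>"
  proof (cases "n = 0")
    case False
    then have "{1..n - 1} = {1..<n}" by auto
    then show ?thesis
      using assms adj_perm_rev[of ys] False
      by (intro r_prod_trivial[of "n - 1"]) (simp_all add: adj_perm_append)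
  qed (use assms in simp)
  then have "inv (r_prod ys) \<otimes> r_prod xs = \<one>" using assms by (simp add: r_prod_append r_prod_rev)
  then show ?thesis using assms r_prod_closed by (metis inv_closed inv_equality inv_inv)
qed

text \<open>By \<open>r_prod_eqI\<close> the product depends only on the permutation, so the choice is immaterial and \<open>rho\<close> is a
homomorphism from the symmetric group.\<close>

definition rho :: "(nat \<Rightarrow> nat) \<Rightarrow> 'a"
  where "rho \<sigma> = r_prod (SOME xs. set xs \<subseteq> {1..<n} \<and> adj_perm xs = \<sigma>)"

lemma rho_adj_perm: "set xs \<subseteq> {1..<n} \<Longrightarrow> rho (adj_perm xs) = r_prod xs"
  unfolding rho_def
  using someI[of "\<lambda>ys. set ys \<subseteq> {1..<n} \<and> adj_perm ys = adj_perm xs" xs]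
  by (intro r_prod_eqI) auto

lemma rho_closed:
  assumes "\<sigma> permutes {1..n}" shows "rho \<sigma> \<in> carrier G"
  using adj_perm_exists[OF assms] rho_adj_perm r_prod_closed by metis

lemma rho_comp:
  assumes "\<sigma> permutes {1..n}" "\<tau> permutes {1..n}"
  shows "rho (\<sigma> \<circ> \<tau>) = rho \<sigma> \<otimes> rho \<tau>"
proof -
  obtain xs ys where xs: "set xs \<subseteq> {1..<n}" "adj_perm xs = \<sigma>" and ys: "set ys \<subseteq> {1..<n}" "adj_perm ys = \<tau>"
    using adj_perm_exists[OF assms(1)] adj_perm_exists[OF assms(2)] by blast
  then have "rho (adj_perm (xs @ ys)) = rho (adj_perm xs) \<otimes> rho (adj_perm ys)"
    by (subst (1 2 3) rho_adj_perm) (auto simp: r_prod_append)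
  then show ?thesis by (simp add: adj_perm_append xs ys)
qed

lemma rho_id: "rho id = \<one>"
  using rho_adj_perm[of "[]"] by simp

lemma rho_transpose: "i \<in> {1..<n} \<Longrightarrow> rho (transpose i (i + 1)) = r i"
  using rho_adj_perm[of "[i]"] r_closed by simp

end

section \<open>The conjugates of a generator of the pure virtual twin group\<close>

locale virtual_twin_generators = coxeter_generators +
  fixes s :: "nat \<Rightarrow> 'a"
  assumes n_ge_2: "n \<ge> 2"
    and s_closed: "i \<in> {1..<n} \<Longrightarrow> s i \<in> carrier G"
    and s_square: "i \<in> {1..<n} \<Longrightarrow> s i \<otimes> s i = \<one>"
    and s_commute: "i \<in> {1..<n} \<Longrightarrow> j \<in> {1..<n} \<Longrightarrow> far i j \<Longrightarrow> s i \<otimes> s j = s j \<otimes> s i"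
    and r_s_commute: "i \<in> {1..<n} \<Longrightarrow> j \<in> {1..<n} \<Longrightarrow> far i j \<Longrightarrow> r i \<otimes> s j = s j \<otimes> r i"
    and mixed: "1 \<le> i \<Longrightarrow> i + 1 < n \<Longrightarrow> r i \<otimes> r (i + 1) \<otimes> s i = s (i + 1) \<otimes> r i \<otimes> r (i + 1)"
begin

definition conj_by :: "'a \<Rightarrow> 'a \<Rightarrow> 'a"
  where "conj_by g x = g \<otimes> x \<otimes> inv g"

lemma conj_by_closed: "g \<in> carrier G \<Longrightarrow> x \<in> carrier G \<Longrightarrow> conj_by g x \<in> carrier G"
  by (simp add: conj_by_def)

lemma conj_by_mult:
  assumes "g \<in> carrier G" "x \<in> carrier G" "y \<in> carrier G"
  shows "conj_by g (x \<otimes> y) = conj_by g x \<otimes> conj_by g y"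
proof -
  have "conj_by g x \<otimes> conj_by g y = g \<otimes> x \<otimes> (inv g \<otimes> g) \<otimes> y \<otimes> inv g"
    using assms by (simp only: conj_by_def m_assoc m_closed inv_closed)
  then show ?thesis using assms by (simp add: conj_by_def m_assoc)
qed

lemma conj_by_inv: "g \<in> carrier G \<Longrightarrow> x \<in> carrier G \<Longrightarrow> conj_by g (inv x) = inv (conj_by g x)"
  by (simp add: conj_by_def inv_mult_group m_assoc)

lemma conj_by_conj_by:
  "g \<in> carrier G \<Longrightarrow> h \<in> carrier G \<Longrightarrow> x \<in> carrier G \<Longrightarrow> conj_by g (conj_by h x) = conj_by (g \<otimes> h) x"
  by (simp add: conj_by_def inv_mult_group m_assoc)

lemma conj_by_eqI:
  assumes "g \<in> carrier G" "x \<in> carrier G" "y \<in> carrier G" "g \<otimes> x = y \<otimes> g"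
  shows "conj_by g x = y"
  using assms by (simp add: conj_by_def m_assoc)

text \<open>The conjugate of \<open>s 1 \<otimes> r 1\<close> by any permutation that moves \<open>1\<close> to \<open>i\<close> and \<open>2\<close> to \<open>j\<close>.  Indexing by ordered pairs
makes conjugation by permutations act on the indices; \<open>lam_swap\<close> shows that reversing the pair
inverts the element.\<close>

definition lam :: "nat \<Rightarrow> nat \<Rightarrow> 'a" where
  "lam i j = conj_by (rho (SOME \<sigma>. \<sigma> permutes {1..n} \<and> \<sigma> 1 = i \<and> \<sigma> 2 = j)) (s 1 \<otimes> r 1)"

lemma base_closed: "s 1 \<otimes> r 1 \<in> carrier G"
  using n_ge_2 by (simp add: s_closed r_closed)

text \<open>A permutation that fixes \<open>1\<close> and \<open>2\<close> is a product of the adjacent transpositions with indices at least \<open>3\<close>,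
and these commute with \<open>s 1\<close> and \<open>r 1\<close> by the far commutation relations.\<close>

lemma stabiliser_commutes:
  assumes "\<sigma> permutes {1..n}" "\<sigma> 1 = 1" "\<sigma> 2 = 2"
  shows "conj_by (rho \<sigma>) (s 1 \<otimes> r 1) = s 1 \<otimes> r 1"
proof -
  have "\<sigma> permutes {3..n}"
  proof (rule permutes_superset[OF assms(1)])
    fix x assume "x \<in> {1..n} - {3..n}"
    then have "x = 1 \<or> x = 2" by auto
    with assms show "\<sigma> x = x" by auto
  qed
  then obtain xs where xs: "set xs \<subseteq> {3..<n}" "adj_perm xs = \<sigma>" using adj_perm_exists by blast
  have "r_prod xs \<otimes> (s 1 \<otimes> r 1) = (s 1 \<otimes> r 1) \<otimes> r_prod xs"
    using xs(1)
  proof (induction xs)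
    case Nil
    then show ?case using base_closed by simp
  next
    case (Cons i xs)
    have i: "i \<in> {1..<n}" "1 \<in> {1..<n}" "far i 1" "set xs \<subseteq> {1..<n}" using Cons.prems by auto
    note cl = r_closed[OF i(1)] r_closed[OF i(2)] s_closed[OF i(2)] r_prod_closed[OF i(4)]
    have "r_prod (i # xs) \<otimes> (s 1 \<otimes> r 1) = r i \<otimes> (s 1 \<otimes> r 1) \<otimes> r_prod xs"
      using Cons cl by (simp add: m_assoc)
    also have "r i \<otimes> (s 1 \<otimes> r 1) = (s 1 \<otimes> r 1) \<otimes> r i"
    proof -
      have "r i \<otimes> (s 1 \<otimes> r 1) = s 1 \<otimes> (r i \<otimes> r 1)"
        using r_s_commute[OF i(1-3)] cl by (simp add: m_assoc[symmetric])
      then show ?thesis using r_commute[OF i(1-3)] cl by (simp add: m_assoc)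
    qed
    finally show ?case using cl by (simp add: m_assoc)
  qed
  moreover have "{3..<n} \<subseteq> {1..<n}" by auto
  then have "rho \<sigma> = r_prod xs" using xs rho_adj_perm[of xs] by blast
  ultimately show ?thesis
    using rho_closed[OF assms(1)] base_closed by (intro conj_by_eqI) auto
qed

lemma lam_eq:
  assumes \<sigma>: "\<sigma> permutes {1..n}"
  shows "lam (\<sigma> 1) (\<sigma> 2) = conj_by (rho \<sigma>) (s 1 \<otimes> r 1)"
proof -
  define \<tau> where "\<tau> = (SOME \<tau>. \<tau> permutes {1..n} \<and> \<tau> 1 = \<sigma> 1 \<and> \<tau> 2 = \<sigma> 2)"
  have \<tau>: "\<tau> permutes {1..n}" "\<tau> 1 = \<sigma> 1" "\<tau> 2 = \<sigma> 2"
    using someI[of "\<lambda>\<tau>. \<tau> permutes {1..n} \<and> \<tau> 1 = \<sigma> 1 \<and> \<tau> 2 = \<sigma> 2" \<sigma>] \<sigma> by (auto simp: \<tau>_def)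
  define \<pi> where "\<pi> = inv_into UNIV \<sigma> \<circ> \<tau>"
  have \<pi>: "\<pi> permutes {1..n}" "\<pi> 1 = 1" "\<pi> 2 = 2"
    using \<tau> \<sigma> permutes_inverses[OF \<sigma>] by (auto simp: \<pi>_def permutes_inv permutes_compose)
  have "\<tau> = \<sigma> \<circ> \<pi>" using permutes_inverses[OF \<sigma>] by (auto simp: \<pi>_def)
  then have "lam (\<sigma> 1) (\<sigma> 2) = conj_by (rho \<sigma>) (conj_by (rho \<pi>) (s 1 \<otimes> r 1))"
    unfolding lam_def \<tau>_def[symmetric]
    using \<sigma> \<pi> base_closed by (simp add: rho_comp conj_by_conj_by rho_closed)
  then show ?thesis using stabiliser_commutes[OF \<pi>] by simp
qed

lemma lam_cases:
  assumes "i \<in> {1..n}" "j \<in> {1..n}" "i \<noteq> j"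
  obtains \<sigma> where "\<sigma> permutes {1..n}" "i = \<sigma> 1" "j = \<sigma> 2"
  using permutation_with_values[of "[1, 2]" "[i, j]" "{1..n}"] assms n_ge_2 by auto

lemma lam_closed:
  assumes "i \<in> {1..n}" "j \<in> {1..n}" "i \<noteq> j"
  shows "lam i j \<in> carrier G"
  using lam_cases[OF assms] lam_eq conj_by_closed[OF rho_closed base_closed] by metis

lemma lam_conj:
  assumes \<sigma>: "\<sigma> permutes {1..n}" and ij: "i \<in> {1..n}" "j \<in> {1..n}" "i \<noteq> j"
  shows "conj_by (rho \<sigma>) (lam i j) = lam (\<sigma> i) (\<sigma> j)"
proof -
  obtain \<tau> where \<tau>: "\<tau> permutes {1..n}" "i = \<tau> 1" "j = \<tau> 2" using lam_cases[OF ij] .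
  have "lam (\<sigma> i) (\<sigma> j) = conj_by (rho (\<sigma> \<circ> \<tau>)) (s 1 \<otimes> r 1)"
    using lam_eq[OF permutes_compose[OF \<tau>(1) \<sigma>]] \<tau> by simp
  then show ?thesis
    using \<tau> \<sigma> lam_eq[OF \<tau>(1)] base_closed by (simp add: rho_comp conj_by_conj_by rho_closed)
qed

lemma lam_1_2: "lam 1 2 = s 1 \<otimes> r 1"
  using lam_eq[of id] base_closed by (simp add: permutes_id rho_id conj_by_def)

text \<open>The mixed relation, together with the braid relation, says that conjugation by \<open>r i \<otimes> r (i + 1)\<close> takes
\<open>s i \<otimes> r i\<close> to its successor; the corresponding permutation shifts \<open>(i, i + 1)\<close> by one.\<close>

lemma lam_adjacent: "i \<in> {1..<n} \<Longrightarrow> lam i (i + 1) = s i \<otimes> r i"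
proof (induction i)
  case (Suc i)
  show ?case
  proof (cases "i = 0")
    case True
    then show ?thesis using lam_1_2 by (simp add: numeral_2_eq_2)
  next
    case False
    with Suc have i: "i \<in> {1..<n}" "i + 1 \<in> {1..<n}" "1 \<le> i" "i + 1 < n" and IH: "lam i (i + 1) = s i \<otimes> r i" by auto
    note cl = r_closed[OF i(1)] r_closed[OF i(2)] s_closed[OF i(1)] s_closed[OF i(2)]
    let ?\<sigma> = "adj_perm [i, i + 1]"
    have \<sigma>: "?\<sigma> permutes {1..n}" using i by (intro adj_perm_permutes) auto
    have "?\<sigma> i = i + 1" "?\<sigma> (i + 1) = i + 2" by (auto simp: transpose_def)
    then have "lam (i + 1) (i + 2) = conj_by (rho ?\<sigma>) (s i \<otimes> r i)"
      using lam_conj[OF \<sigma>, of i "i + 1"] i IH by simp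
    also have "rho ?\<sigma> = r i \<otimes> r (i + 1)" using i cl by (subst rho_adj_perm) auto
    also have "conj_by \<dots> (s i \<otimes> r i) = s (i + 1) \<otimes> r (i + 1)"
    proof (rule conj_by_eqI)
      have "r i \<otimes> r (i + 1) \<otimes> (s i \<otimes> r i) = s (i + 1) \<otimes> (r i \<otimes> r (i + 1) \<otimes> r i)"
        using mixed[OF i(3,4)] cl by (simp only: m_assoc[symmetric] m_closed)
      also have "\<dots> = s (i + 1) \<otimes> (r (i + 1) \<otimes> r i \<otimes> r (i + 1))" by (simp only: r_braid[OF i(3,4)])
      finally show "r i \<otimes> r (i + 1) \<otimes> (s i \<otimes> r i) = s (i + 1) \<otimes> r (i + 1) \<otimes> (r i \<otimes> r (i + 1))"
        using cl by (simp only: m_assoc m_closed)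
    qed (use cl in auto)
    finally show ?thesis by simp
  qed
qed simp

text \<open>For the pair \<open>(1, 2)\<close>, conjugating by the involution \<open>r 1\<close> turns \<open>s 1 \<otimes> r 1\<close> into \<open>r 1 \<otimes> s 1\<close>, which is the
inverse; the general case is a conjugate of this one.\<close>

lemma lam_swap:
  assumes ij: "i \<in> {1..n}" "j \<in> {1..n}" "i \<noteq> j"
  shows "lam j i = inv (lam i j)"
proof -
  have 1: "1 \<in> {1..<n}" "1 \<in> {1..n}" "2 \<in> {1..n}" using n_ge_2 by auto
  note cl = r_closed[OF 1(1)] s_closed[OF 1(1)]
  have t: "transpose 1 2 permutes {1..n}" using 1 by (intro permutes_swap_id)
  have "lam 2 1 = conj_by (rho (transpose 1 2)) (lam 1 2)"
    using lam_conj[OF t 1(2,3)] by simp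
  also have "\<dots> = conj_by (r 1) (s 1 \<otimes> r 1)"
    using rho_transpose[OF 1(1)] by (simp only: lam_1_2 one_add_one)
  also have "\<dots> = inv (s 1 \<otimes> r 1)"
  proof -
    have "inv (r 1) = r 1" "inv (s 1) = s 1"
      using cl r_square[OF 1(1)] s_square[OF 1(1)] by (auto intro: inv_equality)
    then show ?thesis using cl r_square[OF 1(1)]
      by (simp add: conj_by_def inv_mult_group m_assoc)
  qed
  finally have base: "lam 2 1 = inv (lam 1 2)" by (simp only: lam_1_2)
  obtain \<sigma> where \<sigma>: "\<sigma> permutes {1..n}" "i = \<sigma> 1" "j = \<sigma> 2" using lam_cases[OF ij] .
  have "lam j i = conj_by (rho \<sigma>) (lam 2 1)" using lam_conj[OF \<sigma>(1) 1(3,2)] \<sigma> by simp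
  also have "\<dots> = inv (conj_by (rho \<sigma>) (lam 1 2))"
    using base lam_closed[OF 1(2,3)] rho_closed[OF \<sigma>(1)] by (simp add: conj_by_inv)
  also have "\<dots> = inv (lam i j)" using lam_conj[OF \<sigma>(1) 1(2,3)] \<sigma> by simp
  finally show ?thesis .
qed

text \<open>Four distinct indices can be moved to \<open>1, 2, 3, 4\<close>, where the claim is that \<open>s 1 \<otimes> r 1\<close> and \<open>s 3 \<otimes> r 3\<close> commute.\<close>

lemma lam_commute:
  assumes "set [i, j, k, l] \<subseteq> {1..n}" "distinct [i, j, k, l]"
  shows "lam i j \<otimes> lam k l = lam k l \<otimes> lam i j"
proof -
  have "card (set [i, j, k, l]) \<le> card {1..n}" using assms(1) by (intro card_mono) auto
  then have n: "4 \<le> n" using assms(2) by (simp add: distinct_card del: set_simps)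
  obtain \<sigma> where \<sigma>: "\<sigma> permutes {1..n}" "map \<sigma> [1, 2, 3, 4] = [i, j, k, l]"
    using permutation_with_values[of "[1, 2, 3, 4]" "[i, j, k, l]" "{1..n}"] assms n by auto
  have 1: "1 \<in> {1..<n}" "3 \<in> {1..<n}" "far 1 3" "far 3 1" using n by auto
  note cl = r_closed[OF 1(1)] s_closed[OF 1(1)] r_closed[OF 1(2)] s_closed[OF 1(2)]
  have "(s 1 \<otimes> r 1) \<otimes> (s 3 \<otimes> r 3) = (s 3 \<otimes> r 3) \<otimes> (s 1 \<otimes> r 1)"
  proof -
    have "(s 1 \<otimes> r 1) \<otimes> (s 3 \<otimes> r 3) = s 1 \<otimes> (r 1 \<otimes> s 3) \<otimes> r 3" using cl by (simp add: m_assoc)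
    also have "\<dots> = s 1 \<otimes> (s 3 \<otimes> r 1) \<otimes> r 3" by (simp only: r_s_commute[OF 1(1,2,3)])
    also have "\<dots> = (s 1 \<otimes> s 3) \<otimes> (r 1 \<otimes> r 3)" using cl by (simp add: m_assoc)
    also have "\<dots> = (s 3 \<otimes> s 1) \<otimes> (r 3 \<otimes> r 1)"
      using s_commute[OF 1(1,2,3)] r_commute[OF 1(1,2,3)] by simp
    also have "\<dots> = s 3 \<otimes> (s 1 \<otimes> r 3) \<otimes> r 1" using cl by (simp add: m_assoc)
    also have "\<dots> = s 3 \<otimes> (r 3 \<otimes> s 1) \<otimes> r 1" by (simp only: r_s_commute[OF 1(2,1,4)])
    also have "\<dots> = (s 3 \<otimes> r 3) \<otimes> (s 1 \<otimes> r 1)" using cl by (simp add: m_assoc)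
    finally show ?thesis .
  qed
  moreover have "lam 1 2 = s 1 \<otimes> r 1" "lam 3 4 = s 3 \<otimes> r 3"
    using lam_1_2 lam_adjacent[OF 1(2)] by auto
  ultimately have "lam 1 2 \<otimes> lam 3 4 = lam 3 4 \<otimes> lam 1 2" by simp
  then have "conj_by (rho \<sigma>) (lam 1 2 \<otimes> lam 3 4) = conj_by (rho \<sigma>) (lam 3 4 \<otimes> lam 1 2)" by simp
  moreover have "lam 1 2 \<in> carrier G" "lam 3 4 \<in> carrier G" using n by (auto intro: lam_closed)
  ultimately have "conj_by (rho \<sigma>) (lam 1 2) \<otimes> conj_by (rho \<sigma>) (lam 3 4)
      = conj_by (rho \<sigma>) (lam 3 4) \<otimes> conj_by (rho \<sigma>) (lam 1 2)"
    using rho_closed[OF \<sigma>(1)] by (simp add: conj_by_mult)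
  moreover have "conj_by (rho \<sigma>) (lam 1 2) = lam i j" "conj_by (rho \<sigma>) (lam 3 4) = lam k l"
    using lam_conj[OF \<sigma>(1), of 1 2] lam_conj[OF \<sigma>(1), of 3 4] \<sigma>(2) n by auto
  ultimately show ?thesis by simp
qed

end

section \<open>Change of generating set\<close>

lemma raag_rename:
  assumes f: "inj_on f X" and E: "E \<subseteq> X \<times> X"
  shows "raag X E \<cong> raag (f ` X) (map_prod f f ` E)"
proof -
  let ?Y = "f ` X" and ?F = "map_prod f f ` E"
  interpret A: group "raag X E" by (rule group_presented_group)
  interpret B: group "raag ?Y ?F" by (rule group_presented_group)
  define \<alpha> where "\<alpha> = presented_lift (raag ?Y ?F) (\<lambda>x. vertex ?Y ?F (f x))"
  define \<beta> where "\<beta> = presented_lift (raag X E) (\<lambda>y. vertex X E (inv_into X f y))"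
  have \<alpha>: "\<alpha> \<in> hom (raag X E) (raag ?Y ?F)" "\<And>x. x \<in> X \<Longrightarrow> \<alpha> (vertex X E x) = vertex ?Y ?F (f x)"
  proof -
    have 1: "(\<lambda>x. vertex ?Y ?F (f x)) \<in> X \<rightarrow> carrier (raag ?Y ?F)" by (auto intro: gen_closed)
    have 2: "vertex ?Y ?F (f x) \<otimes>\<^bsub>raag ?Y ?F\<^esub> vertex ?Y ?F (f y)
        = vertex ?Y ?F (f y) \<otimes>\<^bsub>raag ?Y ?F\<^esub> vertex ?Y ?F (f x)"
      if "(x, y) \<in> E" "x \<in> X" "y \<in> X" for x y
      using that by (intro vertex_commute) force+
    show "\<alpha> \<in> hom (raag X E) (raag ?Y ?F)" "\<And>x. x \<in> X \<Longrightarrow> \<alpha> (vertex X E x) = vertex ?Y ?F (f x)"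
      unfolding \<alpha>_def using B.raag_lift[OF 1 2] by blast+
  qed
  have \<beta>: "\<beta> \<in> hom (raag ?Y ?F) (raag X E)" "\<And>y. y \<in> ?Y \<Longrightarrow> \<beta> (vertex ?Y ?F y) = vertex X E (inv_into X f y)"
  proof -
    have 1: "(\<lambda>y. vertex X E (inv_into X f y)) \<in> ?Y \<rightarrow> carrier (raag X E)"
      by (auto intro!: gen_closed inv_into_into)
    have 2: "vertex X E (inv_into X f x) \<otimes>\<^bsub>raag X E\<^esub> vertex X E (inv_into X f y)
        = vertex X E (inv_into X f y) \<otimes>\<^bsub>raag X E\<^esub> vertex X E (inv_into X f x)"
      if xy: "(x, y) \<in> ?F" for x y
    proof -
      obtain a b where ab: "(a, b) \<in> E" "x = f a" "y = f b" using xy by auto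
      with E have "a \<in> X" "b \<in> X" by auto
      with ab f show ?thesis by (simp add: inv_into_f_f vertex_commute)
    qed
    show "\<beta> \<in> hom (raag ?Y ?F) (raag X E)" "\<And>y. y \<in> ?Y \<Longrightarrow> \<beta> (vertex ?Y ?F y) = vertex X E (inv_into X f y)"
      unfolding \<beta>_def using A.raag_lift[OF 1 2] by blast+
  qed
  have \<beta>\<alpha>: "\<beta> (\<alpha> g) = g" if "g \<in> carrier (raag X E)" for g
  proof -
    have "(\<beta> \<circ> \<alpha>) g = (\<lambda>g. g) g"
    proof (rule presented_hom_eqI[OF A.group_axioms hom_compose[OF \<alpha>(1) \<beta>(1)] _ _ that])
      show "(\<beta> \<circ> \<alpha>) (vertex X E x) = vertex X E x" if x: "x \<in> X" for x
        using f x by (simp add: \<alpha>(2) \<beta>(2) inv_into_f_f)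
    qed (simp add: hom_def)
    then show ?thesis by simp
  qed
  have \<alpha>\<beta>: "\<alpha> (\<beta> g) = g" if "g \<in> carrier (raag ?Y ?F)" for g
  proof -
    have "(\<alpha> \<circ> \<beta>) g = (\<lambda>g. g) g"
    proof (rule presented_hom_eqI[OF B.group_axioms hom_compose[OF \<beta>(1) \<alpha>(1)] _ _ that])
      show "(\<alpha> \<circ> \<beta>) (vertex ?Y ?F x) = vertex ?Y ?F x" if x: "x \<in> ?Y" for x
        using f x by (auto simp: \<alpha>(2) \<beta>(2) inv_into_f_f)
    qed (simp add: hom_def)
    then show ?thesis by simp
  qed
  have "bij_betw \<alpha> (carrier (raag X E)) (carrier (raag ?Y ?F))"
    using \<alpha>\<beta> \<beta>\<alpha> hom_in_carrier[OF \<alpha>(1)] hom_in_carrier[OF \<beta>(1)]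
    by (intro bij_betw_byWitness[where f' = \<beta>]) auto
  then have "\<alpha> \<in> iso (raag X E) (raag ?Y ?F)" using \<alpha>(1) by (auto simp: iso_def)
  then show ?thesis by (auto simp: is_iso_def)
qed

text \<open>The vertices are distinct elements of the right-angled Artin group, as their exponent sums show, so
their images in \<open>G\<close> serve as a generating set inside the element type of \<open>G\<close>.\<close>

lemma right_angled_Artin_groupI:
  fixes G :: "('a, 'm) monoid_scheme" and X :: "'x set"
  assumes "group G" and E: "E \<subseteq> X \<times> X" and \<phi>: "\<phi> \<in> iso (raag X E) G"
  shows "right_angled_Artin_group G"
proof -
  interpret A: group "raag X E" by (rule group_presented_group)
  define f where "f = \<phi> \<circ> vertex X E"
  have "inj_on \<phi> (vertex X E ` X)"
    using \<phi> by (auto simp: iso_def bij_betw_def gen_closed elim!: inj_on_subset)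
  then have f: "inj_on f X" unfolding f_def by (intro comp_inj_on vertex_inj)
  have "G \<cong> raag X E" using A.iso_sym \<phi> by (auto simp: is_iso_def)
  then have "G \<cong> raag (f ` X) (map_prod f f ` E)" using raag_rename[OF f E] iso_trans by blast
  moreover have "map_prod f f ` E \<subseteq> f ` X \<times> f ` X" using E by auto
  ultimately show ?thesis unfolding right_angled_Artin_group_def using assms(1) by blast
qed

section \<open>Virtual twin groups and the right-angled Artin group of pairs\<close>

lemma class_pos_word:
  assumes "set xs \<subseteq> X"
  shows "word_rel X R `` {pos_word xs}
    = foldr (\<lambda>x g. gen X R x \<otimes>\<^bsub>presented_group X R\<^esub> g) xs \<one>\<^bsub>presented_group X R\<^esub>"
  using assms
proof (induction xs)
  case Nil
  then show ?case by (simp add: pos_word_def presented_one)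
next
  case (Cons x xs)
  then have "word_rel X R `` {(x, True) # pos_word xs}
      = gen X R x \<otimes>\<^bsub>presented_group X R\<^esub> word_rel X R `` {pos_word xs}"
    by (subst class_Cons) auto
  with Cons show ?case by (simp add: pos_word_def)
qed

lemma presented_relation:
  assumes "(pos_word xs, pos_word ys) \<in> R" "set xs \<subseteq> X" "set ys \<subseteq> X"
  shows "foldr (\<lambda>x g. gen X R x \<otimes>\<^bsub>presented_group X R\<^esub> g) xs \<one>\<^bsub>presented_group X R\<^esub>
    = foldr (\<lambda>x g. gen X R x \<otimes>\<^bsub>presented_group X R\<^esub> g) ys \<one>\<^bsub>presented_group X R\<^esub>"
  using assms
  by (simp add: class_pos_word[symmetric] word_rel_class_eq word_cong.relation)

definition pairs :: "nat \<Rightarrow> (nat \<times> nat) set"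
  where "pairs n = {(i, j). 1 \<le> i \<and> i < j \<and> j \<le> n}"

lemma in_pairs: "(i, j) \<in> pairs n \<longleftrightarrow> 1 \<le> i \<and> i < j \<and> j \<le> n"
  by (simp add: pairs_def)

definition disjoint_pairs :: "nat \<Rightarrow> ((nat \<times> nat) \<times> (nat \<times> nat)) set"
  where "disjoint_pairs n =
    {((i, j), (k, l)). (i, j) \<in> pairs n \<and> (k, l) \<in> pairs n \<and> {i, j} \<inter> {k, l} = {}}"

lemma in_disjoint_pairs: "((i, j), (k, l)) \<in> disjoint_pairs n \<longleftrightarrow>
    (i, j) \<in> pairs n \<and> (k, l) \<in> pairs n \<and> {i, j} \<inter> {k, l} = {}"
  by (simp add: disjoint_pairs_def)

locale twin_degree =
  fixes n :: nat
  assumes n_ge_2: "n \<ge> 2"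
begin

abbreviation "VT \<equiv> virtual_twin_group n"
abbreviation "AP \<equiv> raag (pairs n) (disjoint_pairs n)"
abbreviation "r i \<equiv> gen (vt_gens n) (vt_relations n) (Rho i)"
abbreviation "s i \<equiv> gen (vt_gens n) (vt_relations n) (S i)"

sublocale A: group AP
  by (rule group_presented_group)

sublocale V: virtual_twin_generators VT r n s
proof -
  interpret V: group VT by (rule group_virtual_twin_group)
  have gens: "Rho i \<in> vt_gens n" "S i \<in> vt_gens n" if "i \<in> {1..<n}" for i
    using that by (auto simp: vt_gens_def)
  have cl: "r i \<in> carrier VT" "s i \<in> carrier VT" if "i \<in> {1..<n}" for i
    using gens[OF that] by (auto simp: virtual_twin_group_def gen_closed)
  have rel: "foldr (\<lambda>x g. gen (vt_gens n) (vt_relations n) x \<otimes>\<^bsub>VT\<^esub> g) xs \<one>\<^bsub>VT\<^esub>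
      = foldr (\<lambda>x g. gen (vt_gens n) (vt_relations n) x \<otimes>\<^bsub>VT\<^esub> g) ys \<one>\<^bsub>VT\<^esub>"
    if "(pos_word xs, pos_word ys) \<in> vt_relations n" "set xs \<subseteq> vt_gens n" "set ys \<subseteq> vt_gens n"
    for xs ys
    using presented_relation[OF that] by (simp add: virtual_twin_group_def)
  have ranges: "i \<in> {1..<n} \<Longrightarrow> i \<in> {1..n - 1}" "far i j \<Longrightarrow> \<bar>int i - int j\<bar> \<ge> 2"
    "1 \<le> i \<Longrightarrow> i + 1 < n \<Longrightarrow> i \<in> {1..n - 2}" for i j by auto
  have Nil: "pos_word [] = ([] :: vt_gen word)" by (simp add: pos_word_def)
  show "virtual_twin_generators VT r n s"
  proof unfold_locales
    show "r i \<otimes>\<^bsub>VT\<^esub> r i = \<one>\<^bsub>VT\<^esub>" if i: "i \<in> {1..<n}" for i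
    proof -
      have "(pos_word [Rho i, Rho i], pos_word []) \<in> vt_relations n"
        unfolding vt_relations_def Nil using ranges(1)[OF i] by blast
      from rel[OF this] show ?thesis using gens[OF i] cl[OF i] by simp
    qed
    show "s i \<otimes>\<^bsub>VT\<^esub> s i = \<one>\<^bsub>VT\<^esub>" if i: "i \<in> {1..<n}" for i
    proof -
      have "(pos_word [S i, S i], pos_word []) \<in> vt_relations n"
        unfolding vt_relations_def Nil using ranges(1)[OF i] by blast
      from rel[OF this] show ?thesis using gens[OF i] cl[OF i] by simp
    qed
    show "r i \<otimes>\<^bsub>VT\<^esub> r j = r j \<otimes>\<^bsub>VT\<^esub> r i"
      if ij: "i \<in> {1..<n}" "j \<in> {1..<n}" "far i j" for i j
    proof -
      have "(pos_word [Rho i, Rho j], pos_word [Rho j, Rho i]) \<in> vt_relations n"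
        unfolding vt_relations_def using ranges(1)[OF ij(1)] ranges(1)[OF ij(2)] ranges(2)[OF ij(3)] by blast
      from rel[OF this] show ?thesis using gens[OF ij(1)] gens[OF ij(2)] cl[OF ij(1)] cl[OF ij(2)] by simp
    qed
    show "s i \<otimes>\<^bsub>VT\<^esub> s j = s j \<otimes>\<^bsub>VT\<^esub> s i"
      if ij: "i \<in> {1..<n}" "j \<in> {1..<n}" "far i j" for i j
    proof -
      have "(pos_word [S i, S j], pos_word [S j, S i]) \<in> vt_relations n"
        unfolding vt_relations_def using ranges(1)[OF ij(1)] ranges(1)[OF ij(2)] ranges(2)[OF ij(3)] by blast
      from rel[OF this] show ?thesis using gens[OF ij(1)] gens[OF ij(2)] cl[OF ij(1)] cl[OF ij(2)] by simp
    qed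
    show "r i \<otimes>\<^bsub>VT\<^esub> s j = s j \<otimes>\<^bsub>VT\<^esub> r i"
      if ij: "i \<in> {1..<n}" "j \<in> {1..<n}" "far i j" for i j
    proof -
      have "(pos_word [Rho i, S j], pos_word [S j, Rho i]) \<in> vt_relations n"
        unfolding vt_relations_def using ranges(1)[OF ij(1)] ranges(1)[OF ij(2)] ranges(2)[OF ij(3)] by blast
      from rel[OF this] show ?thesis using gens[OF ij(1)] gens[OF ij(2)] cl[OF ij(1)] cl[OF ij(2)] by simp
    qed
    show "r i \<otimes>\<^bsub>VT\<^esub> r (i + 1) \<otimes>\<^bsub>VT\<^esub> r i = r (i + 1) \<otimes>\<^bsub>VT\<^esub> r i \<otimes>\<^bsub>VT\<^esub> r (i + 1)"
      if i: "1 \<le> i" "i + 1 < n" for i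
    proof -
      have ij: "i \<in> {1..<n}" "i + 1 \<in> {1..<n}" using i by auto
      have "(pos_word [Rho i, Rho (i + 1), Rho i], pos_word [Rho (i + 1), Rho i, Rho (i + 1)]) \<in> vt_relations n"
        unfolding vt_relations_def using ranges(3)[OF i] by blast
      from rel[OF this] show ?thesis
        using gens[OF ij(1)] gens[OF ij(2)] cl[OF ij(1)] cl[OF ij(2)] by (simp add: V.m_assoc)
    qed
    show "r i \<otimes>\<^bsub>VT\<^esub> r (i + 1) \<otimes>\<^bsub>VT\<^esub> s i = s (i + 1) \<otimes>\<^bsub>VT\<^esub> r i \<otimes>\<^bsub>VT\<^esub> r (i + 1)"
      if i: "1 \<le> i" "i + 1 < n" for i
    proof -
      have ij: "i \<in> {1..<n}" "i + 1 \<in> {1..<n}" using i by auto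
      have "(pos_word [Rho i, Rho (i + 1), S i], pos_word [S (i + 1), Rho i, Rho (i + 1)]) \<in> vt_relations n"
        unfolding vt_relations_def using ranges(3)[OF i] by blast
      from rel[OF this] show ?thesis
        using gens[OF ij(1)] gens[OF ij(2)] cl[OF ij(1)] cl[OF ij(2)] by (simp add: V.m_assoc)
    qed
  qed (use cl n_ge_2 in auto)
qed

subsection \<open>The symmetric group acts on the right-angled Artin group of pairs\<close>

text \<open>The generator of an ordered pair, under the convention that reversing the pair inverts the generator.
This is the rule that the elements \<open>lam i j\<close> obey, and it lets permutations act through the indices.\<close>

definition edge :: "nat \<Rightarrow> nat \<Rightarrow> (nat \<times> nat) word set" where
  "edge i j = (if i < j then vertex (pairs n) (disjoint_pairs n) (i, j)
     else inv\<^bsub>AP\<^esub> vertex (pairs n) (disjoint_pairs n) (j, i))"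

lemma edge_closed: "i \<in> {1..n} \<Longrightarrow> j \<in> {1..n} \<Longrightarrow> i \<noteq> j \<Longrightarrow> edge i j \<in> carrier AP"
  by (auto simp: edge_def in_pairs intro!: gen_closed A.inv_closed)

lemma edge_swap: "i \<in> {1..n} \<Longrightarrow> j \<in> {1..n} \<Longrightarrow> i \<noteq> j \<Longrightarrow> edge j i = inv\<^bsub>AP\<^esub> edge i j"
  by (auto simp: edge_def in_pairs gen_closed)

lemma edge_commute:
  assumes "set [i, j, k, l] \<subseteq> {1..n}" "distinct [i, j, k, l]"
  shows "edge i j \<otimes>\<^bsub>AP\<^esub> edge k l = edge k l \<otimes>\<^bsub>AP\<^esub> edge i j"
proof -
  let ?c = "\<lambda>x y. x \<otimes>\<^bsub>AP\<^esub> y = y \<otimes>\<^bsub>AP\<^esub> x"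
  have sorted: "?c (edge i j) (edge k l)"
    if "set [i, j, k, l] \<subseteq> {1..n}" "distinct [i, j, k, l]" "i < j" "k < l" for i j k l
  proof -
    have "((i, j), (k, l)) \<in> disjoint_pairs n" using that by (auto simp: in_pairs in_disjoint_pairs)
    then show ?thesis
      using that by (simp add: edge_def, intro vertex_commute) (auto simp: in_disjoint_pairs)
  qed
  have half: "?c (edge i j) (edge k l)"
    if "set [i, j, k, l] \<subseteq> {1..n}" "distinct [i, j, k, l]" "k < l" for i j k l
  proof (cases "i < j")
    case False
    then have "?c (edge j i) (edge k l)" using that by (intro sorted) auto
    then have "?c (inv\<^bsub>AP\<^esub> edge j i) (edge k l)"
      using that by (intro A.inv_commutes) (auto intro: edge_closed)
    then show ?thesis using edge_swap[of j i] that by simp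
  qed (use that sorted in blast)
  show ?thesis
  proof (cases "k < l")
    case False
    then have "?c (edge i j) (edge l k)" using assms by (intro half) auto
    then have "?c (inv\<^bsub>AP\<^esub> edge l k) (edge i j)"
      using assms by (intro A.inv_commutes) (auto intro: edge_closed)
    then show ?thesis using edge_swap[of l k] assms by simp
  qed (use assms half in blast)
qed

definition perm_aut :: "(nat \<Rightarrow> nat) \<Rightarrow> (nat \<times> nat) word set \<Rightarrow> (nat \<times> nat) word set"
  where "perm_aut \<sigma> = presented_lift AP (\<lambda>(i, j). edge (\<sigma> i) (\<sigma> j))"

text \<open>Permutations preserve disjointness of pairs, so the images of commuting generators commute.\<close>

lemma perm_aut:
  assumes \<sigma>: "\<sigma> permutes {1..n}"
  shows perm_aut_hom: "perm_aut \<sigma> \<in> hom AP AP"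
    and perm_aut_edge: "\<And>i j. i \<in> {1..n} \<Longrightarrow> j \<in> {1..n} \<Longrightarrow> i \<noteq> j \<Longrightarrow>
      perm_aut \<sigma> (edge i j) = edge (\<sigma> i) (\<sigma> j)"
proof -
  let ?f = "\<lambda>(i, j). edge (\<sigma> i) (\<sigma> j)"
  have in_n: "\<sigma> i \<in> {1..n}" if "i \<in> {1..n}" for i using \<sigma> that by (simp only: permutes_in_image)
  have inj: "\<sigma> i = \<sigma> j \<longleftrightarrow> i = j" for i j using permutes_inj[OF \<sigma>] by (auto dest: injD)
  have f: "?f \<in> pairs n \<rightarrow> carrier AP"
    by (auto simp: in_pairs inj intro!: edge_closed in_n)
  have comm: "?f p \<otimes>\<^bsub>AP\<^esub> ?f q = ?f q \<otimes>\<^bsub>AP\<^esub> ?f p" if "(p, q) \<in> disjoint_pairs n" for p q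
  proof -
    obtain i j k l where pq: "p = (i, j)" "q = (k, l)" by (cases p, cases q) auto
    then have "set [i, j, k, l] \<subseteq> {1..n}" "distinct [i, j, k, l]"
      using that by (auto simp: in_disjoint_pairs in_pairs)
    then have "edge (\<sigma> i) (\<sigma> j) \<otimes>\<^bsub>AP\<^esub> edge (\<sigma> k) (\<sigma> l) = edge (\<sigma> k) (\<sigma> l) \<otimes>\<^bsub>AP\<^esub> edge (\<sigma> i) (\<sigma> j)"
      using in_n by (intro edge_commute) (auto simp: inj)
    then show ?thesis by (simp add: pq)
  qed
  show hom: "perm_aut \<sigma> \<in> hom AP AP"
    unfolding perm_aut_def using f comm by (rule A.raag_lift(1))
  have vert: "perm_aut \<sigma> (vertex (pairs n) (disjoint_pairs n) (i, j)) = edge (\<sigma> i) (\<sigma> j)"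
    if "(i, j) \<in> pairs n" for i j
    unfolding perm_aut_def using A.raag_lift(2)[OF f comm that] by simp
  interpret p: group_hom AP AP "perm_aut \<sigma>"
    using hom by unfold_locales
  show "perm_aut \<sigma> (edge i j) = edge (\<sigma> i) (\<sigma> j)" if ij: "i \<in> {1..n}" "j \<in> {1..n}" "i \<noteq> j" for i j
  proof (cases "i < j")
    case True
    then show ?thesis using ij vert[of i j] by (simp add: edge_def in_pairs)
  next
    case False
    then have p: "(j, i) \<in> pairs n" using ij by (auto simp: in_pairs)
    have "perm_aut \<sigma> (edge i j) = inv\<^bsub>AP\<^esub> edge (\<sigma> j) (\<sigma> i)"
      using False p vert[OF p] by (simp add: edge_def gen_closed)
    then show ?thesis using edge_swap[of "\<sigma> j" "\<sigma> i"] in_n ij by (simp add: inj)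
  qed
qed

lemma perm_aut_closed: "\<sigma> permutes {1..n} \<Longrightarrow> a \<in> carrier AP \<Longrightarrow> perm_aut \<sigma> a \<in> carrier AP"
  by (rule hom_in_carrier[OF perm_aut_hom])

lemma perm_aut_mult:
  "\<sigma> permutes {1..n} \<Longrightarrow> a \<in> carrier AP \<Longrightarrow> b \<in> carrier AP \<Longrightarrow>
    perm_aut \<sigma> (a \<otimes>\<^bsub>AP\<^esub> b) = perm_aut \<sigma> a \<otimes>\<^bsub>AP\<^esub> perm_aut \<sigma> b"
  by (rule hom_mult[OF perm_aut_hom])

lemma vertex_eq_edge: "(i, j) \<in> pairs n \<Longrightarrow> vertex (pairs n) (disjoint_pairs n) (i, j) = edge i j"
  by (simp add: edge_def in_pairs)

lemma pairsD: "(i, j) \<in> pairs n \<Longrightarrow> i \<in> {1..n} \<and> j \<in> {1..n} \<and> i \<noteq> j"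
  by (auto simp: in_pairs)

lemma perm_aut_comp:
  assumes \<sigma>: "\<sigma> permutes {1..n}" and \<tau>: "\<tau> permutes {1..n}" and a: "a \<in> carrier AP"
  shows "perm_aut \<sigma> (perm_aut \<tau> a) = perm_aut (\<sigma> \<circ> \<tau>) a"
proof -
  have "(perm_aut \<sigma> \<circ> perm_aut \<tau>) a = perm_aut (\<sigma> \<circ> \<tau>) a"
  proof (rule presented_hom_eqI[OF A.group_axioms _ _ _ a])
    show "perm_aut \<sigma> \<circ> perm_aut \<tau> \<in> hom AP AP"
      using perm_aut_hom[OF \<sigma>] perm_aut_hom[OF \<tau>] by (rule hom_compose[rotated])
    show "perm_aut (\<sigma> \<circ> \<tau>) \<in> hom AP AP"
      using \<sigma> \<tau> by (intro perm_aut_hom permutes_compose)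
    fix x assume x: "x \<in> pairs n"
    obtain i j where ij: "x = (i, j)" by (cases x)
    have im: "\<tau> i \<in> {1..n}" "\<tau> j \<in> {1..n}" "\<tau> i \<noteq> \<tau> j"
      using pairsD[of i j] x ij permutes_in_image[OF \<tau>] permutes_inj[OF \<tau>] by (auto dest: injD)
    show "(perm_aut \<sigma> \<circ> perm_aut \<tau>) (vertex (pairs n) (disjoint_pairs n) x)
        = perm_aut (\<sigma> \<circ> \<tau>) (vertex (pairs n) (disjoint_pairs n) x)"
      using x pairsD[of i j] im \<sigma> \<tau> permutes_compose[OF \<tau> \<sigma>]
      by (simp add: ij vertex_eq_edge perm_aut_edge)
  qed
  then show ?thesis by simp
qed

lemma perm_aut_id: "a \<in> carrier AP \<Longrightarrow> perm_aut id a = a"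
proof (rule presented_hom_eqI[OF A.group_axioms, of _ _ _ "\<lambda>a. a"])
  show "perm_aut id \<in> hom AP AP" by (rule perm_aut_hom[OF permutes_id])
  show "perm_aut id (vertex (pairs n) (disjoint_pairs n) x) = vertex (pairs n) (disjoint_pairs n) x"
    if "x \<in> pairs n" for x
    using that pairsD perm_aut_edge[OF permutes_id] by (cases x) (auto simp: vertex_eq_edge)
qed (auto simp: hom_def)

end

subsection \<open>An affine action of the virtual twin group\<close>

context twin_degree
begin

text \<open>In the semidirect product of the right-angled Artin group with the symmetric group, \<open>Rho i\<close> would be
the transposition \<open>t\<close> of \<open>i\<close> and \<open>i + 1\<close>, and \<open>S i\<close> would be \<open>edge i (i + 1)\<close> times \<open>t\<close>.  Instead of building
this product, let its elements act on the right-angled Artin group by affine maps, an automorphism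
followed by a left translation.\<close>

fun affine :: "vt_gen \<Rightarrow> (nat \<times> nat) word set \<Rightarrow> (nat \<times> nat) word set" where
  "affine (Rho i) a = perm_aut (transpose i (i + 1)) a"
| "affine (S i) a = edge i (i + 1) \<otimes>\<^bsub>AP\<^esub> perm_aut (transpose i (i + 1)) a"

text \<open>A formal inverse acts like the letter itself, since the action of every generator is an involution.\<close>

definition affine_word :: "vt_gen word \<Rightarrow> (nat \<times> nat) word set \<Rightarrow> (nat \<times> nat) word set"
  where "affine_word w a = foldr (\<lambda>(x, b). affine x) w a"

lemma affine_word_simps [simp]:
  "affine_word [] a = a"
  "affine_word ((x, b) # w) a = affine x (affine_word w a)"
  "affine_word (u @ w) a = affine_word u (affine_word w a)"
  by (simp_all add: affine_word_def)

lemma adjacent_permutes: "i \<in> {1..<n} \<Longrightarrow> transpose i (i + 1) permutes {1..n}"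
  by (intro permutes_swap_id) auto

lemma adjacent_edge_closed: "i \<in> {1..<n} \<Longrightarrow> edge i (i + 1) \<in> carrier AP"
  by (intro edge_closed) auto

lemma vt_gens_iff [simp]:
  "Rho i \<in> vt_gens n \<longleftrightarrow> i \<in> {1..<n}" "S i \<in> vt_gens n \<longleftrightarrow> i \<in> {1..<n}"
  by (auto simp: vt_gens_def)

lemma affine_closed:
  assumes "x \<in> vt_gens n" "a \<in> carrier AP"
  shows "affine x a \<in> carrier AP"
  using assms adjacent_permutes adjacent_edge_closed
  by (cases x) (simp_all add: perm_aut_closed del: One_nat_def)

lemma affine_word_closed: "w \<in> words (vt_gens n) \<Longrightarrow> a \<in> carrier AP \<Longrightarrow> affine_word w a \<in> carrier AP"
proof (induction w)
  case (Cons p w)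
  then show ?case by (cases p) (simp add: affine_closed)
qed simp

lemma perm_aut_adjacent_edge:
  assumes "\<sigma> permutes {1..n}" "i \<in> {1..<n}"
  shows "perm_aut \<sigma> (edge i (i + 1)) = edge (\<sigma> i) (\<sigma> (i + 1))"
  using assms by (intro perm_aut_edge) auto

text \<open>The transposition reverses the pair \<open>(i, i + 1)\<close>, so the two translations in a repeated \<open>S i\<close> cancel.\<close>

lemma affine_affine:
  assumes x: "x \<in> vt_gens n" and a: "a \<in> carrier AP"
  shows "affine x (affine x a) = a"
proof -
  have main: "perm_aut (transpose i (i + 1)) (perm_aut (transpose i (i + 1)) a) = a"
    if i: "i \<in> {1..<n}" for i
    using perm_aut_comp[OF adjacent_permutes[OF i] adjacent_permutes[OF i] a] perm_aut_id[OF a] by simp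
  show ?thesis
  proof (cases x)
    case (Rho i)
    then show ?thesis using main x by simp
  next
    case (S i)
    with x have i: "i \<in> {1..<n}" by simp
    let ?t = "transpose i (i + 1)"
    have "perm_aut ?t (edge i (i + 1)) = edge (i + 1) i"
      using perm_aut_adjacent_edge[OF adjacent_permutes[OF i] i] by simp
    also have "\<dots> = inv\<^bsub>AP\<^esub> edge i (i + 1)" using i by (intro edge_swap) auto
    finally have e: "perm_aut ?t (edge i (i + 1)) = inv\<^bsub>AP\<^esub> edge i (i + 1)" .
    have "affine x (affine x a) = edge i (i + 1) \<otimes>\<^bsub>AP\<^esub>
        perm_aut ?t (edge i (i + 1) \<otimes>\<^bsub>AP\<^esub> perm_aut ?t a)" using S by simp
    also have "\<dots> = edge i (i + 1) \<otimes>\<^bsub>AP\<^esub> (inv\<^bsub>AP\<^esub> edge i (i + 1) \<otimes>\<^bsub>AP\<^esub> a)"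
      using perm_aut_mult[OF adjacent_permutes[OF i] adjacent_edge_closed[OF i]
          perm_aut_closed[OF adjacent_permutes[OF i] a]] e main[OF i] by simp
    also have "\<dots> = a" using adjacent_edge_closed[OF i] a by (simp add: A.m_assoc[symmetric])
    finally show ?thesis .
  qed
qed

lemma transpose_far:
  assumes "far i j"
  shows "transpose i (i + 1) \<circ> transpose j (j + 1) = transpose j (j + 1) \<circ> transpose i (i + 1)"
  using assms by (auto simp: fun_eq_iff transpose_def)

lemma transpose_braid:
  fixes i :: nat
  shows "transpose i (i + 1) \<circ> transpose (i + 1) (i + 1 + 1) \<circ> transpose i (i + 1) =
   transpose (i + 1) (i + 1 + 1) \<circ> transpose i (i + 1) \<circ> transpose (i + 1) (i + 1 + 1)"
  by (auto simp: fun_eq_iff transpose_def)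

lemma affine_word_relation:
  assumes "(u, v) \<in> vt_relations n" and a: "a \<in> carrier AP"
  shows "affine_word u a = affine_word v a"
proof -
  let ?t = "\<lambda>i. transpose i (i + 1)"
  note P = adjacent_permutes and C = adjacent_edge_closed
  have comm: "perm_aut (?t i) (perm_aut (?t j) a) = perm_aut (?t j) (perm_aut (?t i) a)"
    if "i \<in> {1..<n}" "j \<in> {1..<n}" "far i j" for i j
    using perm_aut_comp[OF P[OF that(1)] P[OF that(2)] a] perm_aut_comp[OF P[OF that(2)] P[OF that(1)] a]
      transpose_far[OF that(3)] by simp
  have fix_edge: "perm_aut (?t i) (edge j (j + 1)) = edge j (j + 1)"
    if "i \<in> {1..<n}" "j \<in> {1..<n}" "far i j" for i j
    using that perm_aut_adjacent_edge[OF P[OF that(1)] that(2)] by (auto simp: transpose_def)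
  have push: "perm_aut (?t i) (edge j (j + 1) \<otimes>\<^bsub>AP\<^esub> perm_aut (?t j) a)
      = edge j (j + 1) \<otimes>\<^bsub>AP\<^esub> perm_aut (?t j) (perm_aut (?t i) a)"
    if ij: "i \<in> {1..<n}" "j \<in> {1..<n}" "far i j" for i j
    using perm_aut_mult[OF P[OF ij(1)] C[OF ij(2)] perm_aut_closed[OF P[OF ij(2)] a]]
      fix_edge[OF ij] comm[OF ij] by simp
  have far: "far i j" if "\<bar>int i - int j\<bar> \<ge> 2" for i j using that by linarith
  have range: "i \<in> {1..n - 1} \<Longrightarrow> i \<in> {1..<n}" for i by auto
  consider
    (SS) i where "i \<in> {1..<n}" "u = pos_word [S i, S i]" "v = []"
  | (RR) i where "i \<in> {1..<n}" "u = pos_word [Rho i, Rho i]" "v = []"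
  | (SSc) i j where "i \<in> {1..<n}" "j \<in> {1..<n}" "far i j" "u = pos_word [S i, S j]" "v = pos_word [S j, S i]"
  | (RRc) i j where "i \<in> {1..<n}" "j \<in> {1..<n}" "far i j" "u = pos_word [Rho i, Rho j]" "v = pos_word [Rho j, Rho i]"
  | (RSc) i j where "i \<in> {1..<n}" "j \<in> {1..<n}" "far i j" "u = pos_word [Rho i, S j]" "v = pos_word [S j, Rho i]"
  | (braid) i where "i \<in> {1..n - 2}" "u = pos_word [Rho i, Rho (i + 1), Rho i]"
      "v = pos_word [Rho (i + 1), Rho i, Rho (i + 1)]"
  | (mixed) i where "i \<in> {1..n - 2}" "u = pos_word [Rho i, Rho (i + 1), S i]"
      "v = pos_word [S (i + 1), Rho i, Rho (i + 1)]"
    using assms(1) unfolding vt_relations_def by (blast dest: far range)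
  then show ?thesis
  proof cases
    case SS
    then show ?thesis using affine_affine[of "S i" a] a by (simp add: pos_word_def)
  next
    case RR
    then show ?thesis using affine_affine[of "Rho i" a] a by (simp add: pos_word_def)
  next
    case SSc
    have far': "far j i" using SSc(3) by auto
    have c: "edge i (i + 1) \<otimes>\<^bsub>AP\<^esub> edge j (j + 1) = edge j (j + 1) \<otimes>\<^bsub>AP\<^esub> edge i (i + 1)"
      using SSc by (intro edge_commute) auto
    have cl: "perm_aut (?t j) (perm_aut (?t i) a) \<in> carrier AP"
      using perm_aut_closed[OF P[OF SSc(2)] perm_aut_closed[OF P[OF SSc(1)] a]] .
    have "edge i (i + 1) \<otimes>\<^bsub>AP\<^esub> (edge j (j + 1) \<otimes>\<^bsub>AP\<^esub> perm_aut (?t j) (perm_aut (?t i) a))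
        = edge j (j + 1) \<otimes>\<^bsub>AP\<^esub> (edge i (i + 1) \<otimes>\<^bsub>AP\<^esub> perm_aut (?t i) (perm_aut (?t j) a))"
      using c cl C[OF SSc(1)] C[OF SSc(2)] comm[OF SSc(1-3)] by (simp add: A.m_assoc[symmetric])
    then show ?thesis
      using push[OF SSc(1-3)] push[OF SSc(2,1) far'] SSc(4,5) by (simp add: pos_word_def)
  next
    case RRc
    then show ?thesis using comm by (simp add: pos_word_def)
  next
    case RSc
    then show ?thesis using push[OF RSc(1-3)] by (simp add: pos_word_def)
  next
    case braid
    then have i: "i \<in> {1..<n}" "i + 1 \<in> {1..<n}" by auto
    note p = P[OF i(1)] P[OF i(2)]
    have "perm_aut (?t i) (perm_aut (?t (i + 1)) (perm_aut (?t i) a))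
        = perm_aut (?t i \<circ> ?t (i + 1) \<circ> ?t i) a"
      by (simp only: perm_aut_comp p a permutes_compose perm_aut_closed o_assoc)
    also have "\<dots> = perm_aut (?t (i + 1) \<circ> ?t i \<circ> ?t (i + 1)) a" by (simp only: transpose_braid)
    also have "\<dots> = perm_aut (?t (i + 1)) (perm_aut (?t i) (perm_aut (?t (i + 1)) a))"
      by (simp only: perm_aut_comp p a permutes_compose perm_aut_closed o_assoc)
    finally show ?thesis using braid by (simp add: pos_word_def)
  next
    case mixed
    then have i: "i \<in> {1..<n}" "i + 1 \<in> {1..<n}" by auto
    note p = P[OF i(1)] P[OF i(2)]
    have pp: "?t i \<circ> ?t (i + 1) permutes {1..n}" using p by (intro permutes_compose)
    have "perm_aut (?t i) (perm_aut (?t (i + 1)) (edge i (i + 1) \<otimes>\<^bsub>AP\<^esub> perm_aut (?t i) a))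
        = perm_aut (?t i \<circ> ?t (i + 1)) (edge i (i + 1)) \<otimes>\<^bsub>AP\<^esub> perm_aut (?t i \<circ> ?t (i + 1) \<circ> ?t i) a"
      using perm_aut_mult[OF pp C[OF i(1)] perm_aut_closed[OF p(1) a]]
      by (simp only: perm_aut_comp p pp a permutes_compose perm_aut_closed A.m_closed C i o_assoc)
    also have "perm_aut (?t i \<circ> ?t (i + 1)) (edge i (i + 1)) = edge (i + 1) (i + 1 + 1)"
      using perm_aut_adjacent_edge[OF pp i(1)] by (simp add: transpose_def)
    also have "perm_aut (?t i \<circ> ?t (i + 1) \<circ> ?t i) a = perm_aut (?t (i + 1) \<circ> ?t i \<circ> ?t (i + 1)) a"
      by (simp only: transpose_braid)
    also have "\<dots> = perm_aut (?t (i + 1)) (perm_aut (?t i) (perm_aut (?t (i + 1)) a))"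
      by (simp only: perm_aut_comp p a permutes_compose perm_aut_closed o_assoc)
    finally show ?thesis using mixed by (simp add: pos_word_def)
  qed
qed

lemma affine_word_cong:
  "word_cong (vt_gens n) (vt_relations n) u v \<Longrightarrow> a \<in> carrier AP \<Longrightarrow> affine_word u a = affine_word v a"
proof (induction arbitrary: a rule: word_cong.induct)
  case (append u u' v v')
  then show ?case using affine_word_closed word_cong_words by (metis affine_word_simps(3))
next
  case (cancel x b)
  then show ?case using affine_affine by simp
next
  case (relation u v)
  then show ?case using affine_word_relation by simp
qed auto

text \<open>The defining relations hold for the action only on the carrier; restricting to it makes congruent words
equal as functions.\<close>

definition affine_act :: "vt_gen word set \<Rightarrow> (nat \<times> nat) word set \<Rightarrow> (nat \<times> nat) word set"
  where "affine_act = on_class (\<lambda>w. restrict (affine_word w) (carrier AP))"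

lemma affine_act_class:
  assumes "w \<in> words (vt_gens n)" "a \<in> carrier AP"
  shows "affine_act (word_rel (vt_gens n) (vt_relations n) `` {w}) a = affine_word w a"
  unfolding affine_act_def
  by (subst on_class[OF _ assms(1)]) (use assms(2) affine_word_cong in \<open>auto intro!: restrict_ext\<close>)

lemma VT_cases:
  assumes "g \<in> carrier VT"
  obtains w where "w \<in> words (vt_gens n)" "g = word_rel (vt_gens n) (vt_relations n) `` {w}"
  using assms unfolding virtual_twin_group_def by (rule presented_carrierE)

lemma affine_act_closed: "g \<in> carrier VT \<Longrightarrow> a \<in> carrier AP \<Longrightarrow> affine_act g a \<in> carrier AP"
  by (auto elim!: VT_cases simp: affine_act_class affine_word_closed)

lemma affine_act_mult:
  "g \<in> carrier VT \<Longrightarrow> h \<in> carrier VT \<Longrightarrow> a \<in> carrier AP \<Longrightarrow>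
    affine_act (g \<otimes>\<^bsub>VT\<^esub> h) a = affine_act g (affine_act h a)"
  by (elim VT_cases)
    (simp add: virtual_twin_group_def presented_mult affine_act_class affine_word_closed)

lemma affine_act_one: "a \<in> carrier AP \<Longrightarrow> affine_act \<one>\<^bsub>VT\<^esub> a = a"
  by (simp add: virtual_twin_group_def presented_one affine_act_class)

lemma affine_act_gen:
  "x \<in> vt_gens n \<Longrightarrow> a \<in> carrier AP \<Longrightarrow> affine_act (gen (vt_gens n) (vt_relations n) x) a = affine x a"
  by (simp add: gen_def affine_act_class)

lemma affine_act_rho:
  assumes \<sigma>: "\<sigma> permutes {1..n}" and a: "a \<in> carrier AP"
  shows "affine_act (V.rho \<sigma>) a = perm_aut \<sigma> a"
proof -
  obtain xs where xs: "set xs \<subseteq> {1..<n}" "adj_perm xs = \<sigma>" using adj_perm_exists[OF \<sigma>] by blast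
  have "affine_act (V.r_prod xs) a = perm_aut (adj_perm xs) a"
    using xs(1)
  proof (induction xs)
    case Nil
    then show ?case using a by (simp add: affine_act_one perm_aut_id[unfolded id_def])
  next
    case (Cons i xs)
    then have i: "i \<in> {1..<n}" and xs: "set xs \<subseteq> {1..<n}" by auto
    have "affine_act (V.r_prod (i # xs)) a = affine_act (r i) (perm_aut (adj_perm xs) a)"
      using Cons.IH[OF xs] affine_act_mult[OF V.r_closed[OF i] V.r_prod_closed[OF xs] a] by simp
    also have "\<dots> = perm_aut (transpose i (i + 1)) (perm_aut (adj_perm xs) a)"
      using i perm_aut_closed[OF adj_perm_permutes[OF xs] a] by (simp add: affine_act_gen)
    also have "\<dots> = perm_aut (adj_perm (i # xs)) a"
      using perm_aut_comp[OF adjacent_permutes[OF i] adj_perm_permutes[OF xs] a] by simp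
    finally show ?case .
  qed
  then show ?thesis using V.rho_adj_perm[OF xs(1)] xs(2) by simp
qed

text \<open>The linear parts of \<open>s 1\<close> and \<open>r 1\<close> cancel, so \<open>s 1 \<otimes> r 1\<close> is a pure translation; conjugation by
\<open>rho \<sigma>\<close> applies \<open>\<sigma>\<close> to its translation vector.\<close>

lemma affine_act_lam:
  assumes ij: "i \<in> {1..n}" "j \<in> {1..n}" "i \<noteq> j" and b: "b \<in> carrier AP"
  shows "affine_act (V.lam i j) b = edge i j \<otimes>\<^bsub>AP\<^esub> b"
proof -
  obtain \<sigma> where \<sigma>: "\<sigma> permutes {1..n}" "i = \<sigma> 1" "j = \<sigma> 2" using V.lam_cases[OF ij] .
  have 1: "1 \<in> {1..<n}" "1 \<in> {1..n}" "2 \<in> {1..n}" using n_ge_2 by auto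
  have \<sigma>': "inv_into UNIV \<sigma> permutes {1..n}" using \<sigma>(1) by (rule permutes_inv)
  have "V.rho (inv_into UNIV \<sigma>) \<otimes>\<^bsub>VT\<^esub> V.rho \<sigma> = \<one>\<^bsub>VT\<^esub>"
    using V.rho_comp[OF \<sigma>' \<sigma>(1)] permutes_inv_o(2)[OF \<sigma>(1)] V.rho_id by simp
  then have inv: "inv\<^bsub>VT\<^esub> V.rho \<sigma> = V.rho (inv_into UNIV \<sigma>)"
    using V.rho_closed[OF \<sigma>(1)] V.rho_closed[OF \<sigma>'] by (intro V.inv_equality)
  define b' where "b' = perm_aut (inv_into UNIV \<sigma>) b"
  have b': "b' \<in> carrier AP" unfolding b'_def by (rule perm_aut_closed[OF \<sigma>' b])
  have b_eq: "perm_aut \<sigma> b' = b"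
    unfolding b'_def using perm_aut_comp[OF \<sigma>(1) \<sigma>' b] permutes_inv_o(1)[OF \<sigma>(1)] perm_aut_id[OF b] by simp
  have base: "affine_act (s 1 \<otimes>\<^bsub>VT\<^esub> r 1) b' = edge 1 2 \<otimes>\<^bsub>AP\<^esub> b'"
  proof -
    have "affine_act (s 1 \<otimes>\<^bsub>VT\<^esub> r 1) b' = affine (S 1) (affine (Rho 1) b')"
      using affine_act_mult[OF V.s_closed[OF 1(1)] V.r_closed[OF 1(1)] b'] 1(1) b'
        affine_closed[of "Rho 1" b'] by (simp add: affine_act_gen del: affine.simps)
    also have "\<dots> = edge 1 (1 + 1) \<otimes>\<^bsub>AP\<^esub> affine (Rho 1) (affine (Rho 1) b')" by simp
    also have "\<dots> = edge 1 2 \<otimes>\<^bsub>AP\<^esub> b'"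
      using affine_affine[of "Rho 1" b'] 1(1) b' by (simp only: one_add_one vt_gens_iff)
    finally show ?thesis .
  qed
  have "affine_act (V.lam i j) b = affine_act (V.rho \<sigma>) (affine_act (s 1 \<otimes>\<^bsub>VT\<^esub> r 1) b')"
    using V.lam_eq[OF \<sigma>(1)] \<sigma>(2,3) V.rho_closed[OF \<sigma>(1)] V.rho_closed[OF \<sigma>'] V.base_closed b
      b'[unfolded b'_def]
    by (simp add: V.conj_by_def inv affine_act_mult affine_act_closed affine_act_rho[OF \<sigma>' b] b'_def)
  also have "\<dots> = perm_aut \<sigma> (edge 1 2 \<otimes>\<^bsub>AP\<^esub> b')"
    using base affine_act_rho[OF \<sigma>(1)] edge_closed[OF 1(2,3)] b' by simp
  also have "\<dots> = edge i j \<otimes>\<^bsub>AP\<^esub> b"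
    using perm_aut_mult[OF \<sigma>(1) edge_closed[OF 1(2,3)] b'] perm_aut_edge[OF \<sigma>(1) 1(2,3)] b_eq \<sigma>(2,3)
    by simp
  finally show ?thesis .
qed

subsection \<open>The isomorphism with the pure virtual twin group\<close>

definition to_VT :: "(nat \<times> nat) word set \<Rightarrow> vt_gen word set"
  where "to_VT = presented_lift VT (\<lambda>(i, j). V.lam i j)"

lemma to_VT:
  shows to_VT_hom: "to_VT \<in> hom AP VT"
    and to_VT_edge: "\<And>i j. i \<in> {1..n} \<Longrightarrow> j \<in> {1..n} \<Longrightarrow> i \<noteq> j \<Longrightarrow> to_VT (edge i j) = V.lam i j"
proof -
  let ?f = "\<lambda>(i, j). V.lam i j"
  have f: "?f \<in> pairs n \<rightarrow> carrier VT"
    using pairsD V.lam_closed by auto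
  have comm: "?f p \<otimes>\<^bsub>VT\<^esub> ?f q = ?f q \<otimes>\<^bsub>VT\<^esub> ?f p" if "(p, q) \<in> disjoint_pairs n" for p q
  proof -
    obtain i j k l where pq: "p = (i, j)" "q = (k, l)" by (cases p, cases q) auto
    then have "set [i, j, k, l] \<subseteq> {1..n}" "distinct [i, j, k, l]"
      using that by (auto simp: in_disjoint_pairs in_pairs)
    from V.lam_commute[OF this] show ?thesis by (simp add: pq)
  qed
  show hom: "to_VT \<in> hom AP VT"
    unfolding to_VT_def using f comm by (rule V.raag_lift(1))
  have vert: "to_VT (vertex (pairs n) (disjoint_pairs n) (i, j)) = V.lam i j" if "(i, j) \<in> pairs n" for i j
    unfolding to_VT_def using V.raag_lift(2)[OF f comm that] by simp
  interpret p: group_hom AP VT to_VT using hom by unfold_locales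
  show "to_VT (edge i j) = V.lam i j" if ij: "i \<in> {1..n}" "j \<in> {1..n}" "i \<noteq> j" for i j
  proof (cases "i < j")
    case True
    then show ?thesis using ij vert[of i j] by (simp add: edge_def in_pairs)
  next
    case False
    then have p: "(j, i) \<in> pairs n" using ij by (auto simp: in_pairs)
    have "to_VT (edge i j) = inv\<^bsub>VT\<^esub> V.lam j i"
      using False p vert[OF p] by (simp add: edge_def gen_closed)
    then show ?thesis using V.lam_swap[OF ij(2,1)] ij by simp
  qed
qed

lemma to_VT_closed: "a \<in> carrier AP \<Longrightarrow> to_VT a \<in> carrier VT"
  by (rule hom_in_carrier[OF to_VT_hom])

lemma to_VT_mult: "a \<in> carrier AP \<Longrightarrow> b \<in> carrier AP \<Longrightarrow> to_VT (a \<otimes>\<^bsub>AP\<^esub> b) = to_VT a \<otimes>\<^bsub>VT\<^esub> to_VT b"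
  by (rule hom_mult[OF to_VT_hom])

text \<open>Every \<open>to_VT a\<close> is the translation by \<open>a\<close>, because this holds for generators; hence \<open>a\<close> can be
recovered from \<open>to_VT a\<close> as the image of the unit element.\<close>

lemma affine_act_to_VT:
  assumes "a \<in> carrier AP" "b \<in> carrier AP"
  shows "affine_act (to_VT a) b = a \<otimes>\<^bsub>AP\<^esub> b"
  using assms
proof (induction arbitrary: b rule: presented_induct)
  case one
  then show ?case using hom_one[OF to_VT_hom A.group_axioms V.group_axioms] affine_act_one by simp
next
  case (gen x h)
  obtain i j where x: "x = (i, j)" by (cases x)
  with gen.hyps have ij: "(i, j) \<in> pairs n" "i \<in> {1..n}" "j \<in> {1..n}" "i \<noteq> j" using pairsD by auto
  note cl = edge_closed[OF ij(2-4)]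
  have "affine_act (to_VT (edge i j \<otimes>\<^bsub>AP\<^esub> h)) b = edge i j \<otimes>\<^bsub>AP\<^esub> (h \<otimes>\<^bsub>AP\<^esub> b)"
    using cl gen ij
    by (simp add: to_VT_mult to_VT_closed affine_act_mult to_VT_edge V.lam_closed affine_act_lam)
  then show ?case using cl gen by (simp add: x vertex_eq_edge[OF ij(1)] A.m_assoc)
next
  case (inv_gen x h)
  obtain i j where x: "x = (i, j)" by (cases x)
  with inv_gen.hyps have ij: "(i, j) \<in> pairs n" "i \<in> {1..n}" "j \<in> {1..n}" "i \<noteq> j" using pairsD by auto
  note cl = edge_closed[OF ij(2-4)] edge_closed[OF ij(3,2) ij(4)[symmetric]]
  have "affine_act (to_VT (edge j i \<otimes>\<^bsub>AP\<^esub> h)) b = edge j i \<otimes>\<^bsub>AP\<^esub> (h \<otimes>\<^bsub>AP\<^esub> b)"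
    using cl inv_gen ij
    by (simp add: to_VT_mult to_VT_closed affine_act_mult to_VT_edge V.lam_closed affine_act_lam)
  then show ?case using cl inv_gen edge_swap[OF ij(2-4)]
    by (simp add: x vertex_eq_edge[OF ij(1)] A.m_assoc)
qed

lemma to_VT_inj: "inj_on to_VT (carrier AP)"
proof (rule inj_onI)
  fix a b assume ab: "a \<in> carrier AP" "b \<in> carrier AP" "to_VT a = to_VT b"
  have "a \<otimes>\<^bsub>AP\<^esub> \<one>\<^bsub>AP\<^esub> = b \<otimes>\<^bsub>AP\<^esub> \<one>\<^bsub>AP\<^esub>"
    unfolding affine_act_to_VT[OF ab(1) A.one_closed, symmetric] affine_act_to_VT[OF ab(2) A.one_closed, symmetric]
    by (simp only: ab(3))
  then show "a = b" using ab(1,2) by (simp only: A.r_one)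
qed

lemma conj_by_rho_to_VT:
  assumes \<sigma>: "\<sigma> permutes {1..n}" and a: "a \<in> carrier AP"
  shows "V.conj_by (V.rho \<sigma>) (to_VT a) = to_VT (perm_aut \<sigma> a)"
proof -
  note g = V.rho_closed[OF \<sigma>]
  have "V.conj_by (V.rho \<sigma>) \<in> hom VT VT"
    using g by (auto intro!: homI simp: V.conj_by_closed V.conj_by_mult)
  then have 1: "V.conj_by (V.rho \<sigma>) \<circ> to_VT \<in> hom AP VT" by (rule hom_compose[OF to_VT_hom])
  have 2: "to_VT \<circ> perm_aut \<sigma> \<in> hom AP VT" by (rule hom_compose[OF perm_aut_hom[OF \<sigma>] to_VT_hom])
  have "(V.conj_by (V.rho \<sigma>) \<circ> to_VT) a = (to_VT \<circ> perm_aut \<sigma>) a"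
  proof (rule presented_hom_eqI[OF V.group_axioms 1 2 _ a])
    fix x assume x: "x \<in> pairs n"
    obtain i j where ij: "x = (i, j)" by (cases x)
    have d: "i \<in> {1..n}" "j \<in> {1..n}" "i \<noteq> j" using pairsD x ij by auto
    have im: "\<sigma> i \<in> {1..n}" "\<sigma> j \<in> {1..n}" "\<sigma> i \<noteq> \<sigma> j"
      using d permutes_in_image[OF \<sigma>] permutes_inj[OF \<sigma>] by (auto dest: injD)
    show "(V.conj_by (V.rho \<sigma>) \<circ> to_VT) (vertex (pairs n) (disjoint_pairs n) x)
        = (to_VT \<circ> perm_aut \<sigma>) (vertex (pairs n) (disjoint_pairs n) x)"
      unfolding ij vertex_eq_edge[OF x[unfolded ij]] o_apply perm_aut_edge[OF \<sigma> d]
        to_VT_edge[OF d] to_VT_edge[OF im] by (rule V.lam_conj[OF \<sigma> d])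
  qed
  then show ?thesis by simp
qed

lemma s_r_mult_decomposed:
  assumes i: "i \<in> {1..<n}" and a: "a \<in> carrier AP" and \<sigma>: "\<sigma> permutes {1..n}"
  defines "t \<equiv> transpose i (i + 1)"
  shows "r i \<otimes>\<^bsub>VT\<^esub> (to_VT a \<otimes>\<^bsub>VT\<^esub> V.rho \<sigma>) = to_VT (perm_aut t a) \<otimes>\<^bsub>VT\<^esub> V.rho (t \<circ> \<sigma>)"
    and "s i \<otimes>\<^bsub>VT\<^esub> (to_VT a \<otimes>\<^bsub>VT\<^esub> V.rho \<sigma>)
      = to_VT (edge i (i + 1) \<otimes>\<^bsub>AP\<^esub> perm_aut t a) \<otimes>\<^bsub>VT\<^esub> V.rho (t \<circ> \<sigma>)"
proof -
  have t: "t permutes {1..n}" unfolding t_def by (rule adjacent_permutes[OF i])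
  note cl = V.r_closed[OF i] V.s_closed[OF i] to_VT_closed[OF a] V.rho_closed[OF \<sigma>]
    to_VT_closed[OF perm_aut_closed[OF t a]]
  have rt: "V.rho t = r i" unfolding t_def by (rule V.rho_transpose[OF i])
  have "to_VT (perm_aut t a) = r i \<otimes>\<^bsub>VT\<^esub> to_VT a \<otimes>\<^bsub>VT\<^esub> inv\<^bsub>VT\<^esub> r i"
    using conj_by_rho_to_VT[OF t a] rt by (simp add: V.conj_by_def)
  then have "to_VT (perm_aut t a) \<otimes>\<^bsub>VT\<^esub> r i = r i \<otimes>\<^bsub>VT\<^esub> to_VT a"
    using cl by (simp add: V.m_assoc)
  then show r: "r i \<otimes>\<^bsub>VT\<^esub> (to_VT a \<otimes>\<^bsub>VT\<^esub> V.rho \<sigma>) = to_VT (perm_aut t a) \<otimes>\<^bsub>VT\<^esub> V.rho (t \<circ> \<sigma>)"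
    using V.rho_comp[OF t \<sigma>] rt cl by (simp add: V.m_assoc[symmetric])
  have "s i = to_VT (edge i (i + 1)) \<otimes>\<^bsub>VT\<^esub> r i"
    using to_VT_edge[of i "i + 1"] V.lam_adjacent[OF i] V.r_square[OF i] i cl by (simp add: V.m_assoc)
  then have "s i \<otimes>\<^bsub>VT\<^esub> (to_VT a \<otimes>\<^bsub>VT\<^esub> V.rho \<sigma>)
      = to_VT (edge i (i + 1)) \<otimes>\<^bsub>VT\<^esub> (r i \<otimes>\<^bsub>VT\<^esub> (to_VT a \<otimes>\<^bsub>VT\<^esub> V.rho \<sigma>))"
    using cl to_VT_closed[OF adjacent_edge_closed[OF i]] by (simp add: V.m_assoc)
  also have "\<dots> = to_VT (edge i (i + 1) \<otimes>\<^bsub>AP\<^esub> perm_aut t a) \<otimes>\<^bsub>VT\<^esub> V.rho (t \<circ> \<sigma>)"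
    using r cl to_VT_closed[OF adjacent_edge_closed[OF i]] V.rho_closed[OF permutes_compose[OF \<sigma> t]]
      to_VT_mult[OF adjacent_edge_closed[OF i] perm_aut_closed[OF t a]]
    by (simp add: V.m_assoc)
  finally show "s i \<otimes>\<^bsub>VT\<^esub> (to_VT a \<otimes>\<^bsub>VT\<^esub> V.rho \<sigma>)
      = to_VT (edge i (i + 1) \<otimes>\<^bsub>AP\<^esub> perm_aut t a) \<otimes>\<^bsub>VT\<^esub> V.rho (t \<circ> \<sigma>)" .
qed

text \<open>Products of this form contain the unit and are stable under left multiplication by each generator:
\<open>r i\<close> normalises the image of \<open>to_VT\<close>, and \<open>s i = lam i (i + 1) \<otimes> r i\<close>.\<close>

lemma decomposition:
  assumes "g \<in> carrier VT"
  shows "\<exists>a \<sigma>. a \<in> carrier AP \<and> \<sigma> permutes {1..n} \<and> g = to_VT a \<otimes>\<^bsub>VT\<^esub> V.rho \<sigma>"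
proof -
  let ?P = "\<lambda>g. \<exists>a \<sigma>. a \<in> carrier AP \<and> \<sigma> permutes {1..n} \<and> g = to_VT a \<otimes>\<^bsub>VT\<^esub> V.rho \<sigma>"
  let ?g = "gen (vt_gens n) (vt_relations n)"
  have one: "?P \<one>\<^bsub>VT\<^esub>"
    using V.rho_id permutes_id[of "{1..n}"] hom_one[OF to_VT_hom A.group_axioms V.group_axioms]
    by (intro exI[of _ "\<one>\<^bsub>AP\<^esub>"] exI[of _ id] conjI) simp_all
  have step: "?P (?g x \<otimes>\<^bsub>VT\<^esub> h)" if x: "x \<in> vt_gens n" and h: "?P h" for x h
  proof -
    obtain a \<sigma> where a: "a \<in> carrier AP" and \<sigma>: "\<sigma> permutes {1..n}" and h: "h = to_VT a \<otimes>\<^bsub>VT\<^esub> V.rho \<sigma>"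
      using h by blast
    show ?thesis
    proof (cases x)
      case (Rho i)
      with x have i: "i \<in> {1..<n}" by simp
      note t = adjacent_permutes[OF i]
      show ?thesis
        unfolding Rho h s_r_mult_decomposed(1)[OF i a \<sigma>]
        using perm_aut_closed[OF t a] permutes_compose[OF \<sigma> t] by blast
    next
      case (S i)
      with x have i: "i \<in> {1..<n}" by simp
      note t = adjacent_permutes[OF i]
      show ?thesis
        unfolding S h s_r_mult_decomposed(2)[OF i a \<sigma>]
        using A.m_closed[OF adjacent_edge_closed[OF i] perm_aut_closed[OF t a]] permutes_compose[OF \<sigma> t]
        by blast
    qed
  qed
  have inv: "inv\<^bsub>VT\<^esub> ?g x = ?g x" if x: "x \<in> vt_gens n" for x
  proof (cases x)
    case (Rho i)
    with x have "i \<in> {1..<n}" by simp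
    with Rho show ?thesis by (simp only: V.inv_equality V.r_square V.r_closed)
  next
    case (S i)
    with x have "i \<in> {1..<n}" by simp
    with S show ?thesis by (simp only: V.inv_equality V.s_square V.s_closed)
  qed
  show ?thesis
    using assms one step inv presented_induct[of g "vt_gens n" "vt_relations n" ?P]
    unfolding virtual_twin_group_def by simp
qed

lemma vt_proj_r_s:
  assumes "i \<in> {1..<n}"
  shows "vt_proj n (r i) = transpose i (i + 1)" "vt_proj n (s i) = transpose i (i + 1)"
  using assms vt_proj_generator[of "Rho i" n] vt_proj_generator[of "S i" n]
  by (simp_all add: gen_def pos_word_def)

lemma vt_proj_one: "vt_proj n \<one>\<^bsub>VT\<^esub> = id"
  using hom_one[OF vt_proj_hom V.group_axioms sym_group_is_group] by (simp add: sym_group_one)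

lemma vt_proj_mult:
  "g \<in> carrier VT \<Longrightarrow> h \<in> carrier VT \<Longrightarrow> vt_proj n (g \<otimes>\<^bsub>VT\<^esub> h) = vt_proj n g \<circ> vt_proj n h"
  using hom_mult[OF vt_proj_hom, of g n h] by (simp add: sym_group_mult)

lemma vt_proj_rho:
  assumes \<sigma>: "\<sigma> permutes {1..n}"
  shows "vt_proj n (V.rho \<sigma>) = \<sigma>"
proof -
  obtain xs where xs: "set xs \<subseteq> {1..<n}" "adj_perm xs = \<sigma>" using adj_perm_exists[OF \<sigma>] by blast
  have "vt_proj n (V.r_prod xs) = adj_perm xs"
    using xs(1)
  proof (induction xs)
    case (Cons i xs)
    then have i: "i \<in> {1..<n}" "set xs \<subseteq> {1..<n}" by auto
    then show ?case
      using Cons.IH vt_proj_mult[OF V.r_closed[OF i(1)] V.r_prod_closed[OF i(2)]] vt_proj_r_s(1)[OF i(1)]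
      by simp
  qed (simp add: vt_proj_one)
  then show ?thesis using V.rho_adj_perm[OF xs(1)] xs(2) by simp
qed

lemma vt_proj_lam:
  assumes ij: "i \<in> {1..n}" "j \<in> {1..n}" "i \<noteq> j"
  shows "vt_proj n (V.lam i j) = id"
proof -
  obtain \<sigma> where \<sigma>: "\<sigma> permutes {1..n}" "i = \<sigma> 1" "j = \<sigma> 2" using V.lam_cases[OF ij] .
  have 1: "1 \<in> {1..<n}" using n_ge_2 by auto
  note g = V.rho_closed[OF \<sigma>(1)]
  have "vt_proj n (s 1 \<otimes>\<^bsub>VT\<^esub> r 1) = id"
    using vt_proj_mult[OF V.s_closed[OF 1] V.r_closed[OF 1]] vt_proj_r_s[OF 1] by simp
  then have "vt_proj n (V.lam i j) = vt_proj n (V.rho \<sigma>) \<circ> id \<circ> vt_proj n (inv\<^bsub>VT\<^esub> V.rho \<sigma>)"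
    using V.lam_eq[OF \<sigma>(1)] \<sigma>(2,3) V.base_closed g by (simp add: V.conj_by_def vt_proj_mult)
  also have "\<dots> = vt_proj n (V.rho \<sigma> \<otimes>\<^bsub>VT\<^esub> inv\<^bsub>VT\<^esub> V.rho \<sigma>)"
    using vt_proj_mult[OF g V.inv_closed[OF g]] by simp
  also have "\<dots> = id" using g vt_proj_one by simp
  finally show ?thesis .
qed

lemma vt_proj_to_VT:
  assumes "a \<in> carrier AP"
  shows "vt_proj n (to_VT a) = id"
proof -
  have "(vt_proj n \<circ> to_VT) a = (\<lambda>a. id) a"
  proof (rule presented_hom_eqI[OF sym_group_is_group hom_compose[OF to_VT_hom vt_proj_hom] _ _ assms])
    show "(\<lambda>a. id) \<in> hom AP (sym_group n)"
      by (auto intro!: homI simp: sym_group_mult sym_group_carrier permutes_id)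
    fix x assume x: "x \<in> pairs n"
    obtain i j where ij: "x = (i, j)" by (cases x)
    then show "(vt_proj n \<circ> to_VT) (vertex (pairs n) (disjoint_pairs n) x) = id"
      using x pairsD[of i j] by (simp add: vertex_eq_edge to_VT_edge vt_proj_lam)
  qed
  then show ?thesis by simp
qed

text \<open>By \<open>vt_proj_lam\<close> the image of \<open>to_VT\<close> is pure, so the permutation of \<open>to_VT a \<otimes> rho \<sigma>\<close> is \<open>\<sigma>\<close>; it is the identity
only if \<open>rho \<sigma>\<close> is trivial.\<close>

lemma to_VT_image: "to_VT ` carrier AP = kernel VT (sym_group n) (vt_proj n)"
proof (intro equalityI subsetI)
  fix g assume "g \<in> to_VT ` carrier AP"
  then show "g \<in> kernel VT (sym_group n) (vt_proj n)"
    by (auto simp: kernel_def sym_group_one vt_proj_to_VT to_VT_closed)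
next
  fix g assume "g \<in> kernel VT (sym_group n) (vt_proj n)"
  then have g: "g \<in> carrier VT" "vt_proj n g = id" by (auto simp: kernel_def sym_group_one)
  obtain a \<sigma> where a: "a \<in> carrier AP" and \<sigma>: "\<sigma> permutes {1..n}" and eq: "g = to_VT a \<otimes>\<^bsub>VT\<^esub> V.rho \<sigma>"
    using decomposition[OF g(1)] by blast
  have "vt_proj n g = \<sigma>"
    using a \<sigma> by (simp add: eq vt_proj_mult to_VT_closed V.rho_closed vt_proj_to_VT vt_proj_rho)
  then have "g = to_VT a" using g(2) eq V.rho_id to_VT_closed[OF a] by simp
  then show "g \<in> to_VT ` carrier AP" using a by blast
qed

theorem to_VT_iso: "to_VT \<in> iso AP (pure_virtual_twin_group n)"
  using to_VT_hom to_VT_inj to_VT_image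
  by (auto simp: iso_def hom_def bij_betw_def pure_virtual_twin_group_def)

end

section \<open>Irreducibility of the pure virtual twin group\<close>

text \<open>Pairs that meet are joined by an edge, and disjoint pairs \<open>(i, j)\<close> and \<open>(k, l)\<close> both meet the pair formed by
\<open>i\<close> and \<open>k\<close>.\<close>

lemma noncommuting_pairs_connected:
  assumes "p \<in> pairs n" "q \<in> pairs n"
  shows "(p, q) \<in> (noncommuting (pairs n) (disjoint_pairs n))\<^sup>*"
proof -
  let ?N = "noncommuting (pairs n) (disjoint_pairs n)"
  have meet: "(x, y) \<in> ?N\<^sup>*"
    if "x \<in> pairs n" "y \<in> pairs n" "{fst x, snd x} \<inter> {fst y, snd y} \<noteq> {}" for x y
  proof (cases "x = y")
    case False
    obtain a b c d where "x = (a, b)" "y = (c, d)" by (cases x, cases y) auto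
    with that False have "(x, y) \<in> ?N" by (auto simp: noncommuting_def in_disjoint_pairs)
    then show ?thesis by blast
  qed simp
  obtain i j k l where ij: "p = (i, j)" and kl: "q = (k, l)" by (cases p, cases q) auto
  show ?thesis
  proof (cases "i = k")
    case True
    then show ?thesis using assms ij kl by (intro meet) auto
  next
    case False
    define m where "m = (min i k, max i k)"
    have m: "m \<in> pairs n" using assms ij kl False by (auto simp: m_def in_pairs)
    have "(p, m) \<in> ?N\<^sup>*" "(m, q) \<in> ?N\<^sup>*"
      using assms m ij kl by (intro meet; auto simp: m_def min_def max_def)+
    then show ?thesis by (rule rtrancl_trans)
  qed
qed

theorem corollary3p4:
  fixes n :: nat
  assumes "n \<ge> 2"
  shows "right_angled_Artin_group (pure_virtual_twin_group n) \<and>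
    irreducible_group (pure_virtual_twin_group n)"
proof
  interpret twin_degree n by unfold_locales (rule assms)
  have "disjoint_pairs n \<subseteq> pairs n \<times> pairs n" by (auto simp: disjoint_pairs_def)
  then show "right_angled_Artin_group (pure_virtual_twin_group n)"
    using right_angled_Artin_groupI[OF group_pure_virtual_twin_group _ to_VT_iso] by blast
  show "irreducible_group (pure_virtual_twin_group n)"
    unfolding irreducible_group_def
  proof safe
    fix H K :: "vt_gen word set monoid"
    assume HK: "group H" "group K" "\<not> trivial_group H" "\<not> trivial_group K"
      and "pure_virtual_twin_group n \<cong> H \<times>\<times> K"
    then have "AP \<cong> H \<times>\<times> K" using to_VT_iso iso_trans by (auto simp: is_iso_def)
    from raag_irreducible[OF noncommuting_pairs_connected HK(1,2) this] HK(3,4)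
    show False by blast
  qed
qed

end
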